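(* Let $\beta_0$ be the closed Bézier curve of degree $6$ with control points $(0,9,20)$, $(-15,-95,-50)$, $(40,80,-20)$, $(-10,-60,58)$, $(-60,30,20)$, $(40,-60,-60)$, $(0,9,20)$, and let $K_{0,4}$ be the closed PL curve obtained from these control points by four iterations of de Casteljau subdivision with parameter $\tfrac12$. Then $\beta_0$ is ambient isotopic to $K_{0,4}$, which is the unknot.
   Context: The Bézier curve of degree $n$ with control points $P_0,\dots,P_n\in\mathbb{R}^3$ is $\mathcal{C}(t)=\sum_{i=0}^n \binom{n}{i}t^i(1-t)^{n-i}P_i$, $t\in[0,1]$; curves are identified with their images. One step of de Casteljau subdivision (parameter $\tfrac12$) applied to $(Q_0,\dots,Q_n)$: put $Q_k^{(0)}=Q_k$, $Q_k^{(r)}=\tfrac12(Q_k^{(r-1)}+Q_{k+1}^{(r-1)})$, and output the left list $(Q_0^{(0)},Q_0^{(1)},\dots,Q_0^{(n)})$ and the right list $(Q_0^{(n)},Q_1^{(n-1)},\dots,Q_n^{(0)})$. Each further iteration applies this step to every list. After four iterations there are $16$ lists; the PL curve through each list is a sub-control polygon, and $K_{0,4}$ is their union. Ambient isotopy between $X,Y\subset\mathbb{R}^3$: a continuous $H:\mathbb{R}^3\times[0,1]\to\mathbb{R}^3$ with $H(\cdot,0)=\mathrm{id}$, $H(X,1)=Y$, and each $H(\cdot,t)$ a homeomorphism of $\mathbb{R}^3$ onto $\mathbb{R}^3$. A subset is the unknot if it is ambient isotopic to a standard planar circle. *)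

theory Defs
  imports "HOL-Analysis.Analysis"
begin

text \<open>A list \<open>P\<close> of \<open>n + 1\<close> control points is indexed from \<open>0\<close> to \<open>n = length P - 1\<close>.\<close>

definition bezier :: "'a::real_normed_vector list \<Rightarrow> real \<Rightarrow> 'a" where
  "bezier P t = (\<Sum>i = 0..length P - 1. Bernstein (length P - 1) i t *\<^sub>R P ! i)"

definition bezier_curve :: "'a::real_normed_vector list \<Rightarrow> 'a set" where
  "bezier_curve P = path_image (bezier P)"

text \<open>\<open>de_casteljau Q r k\<close> is the point \<open>Q\<^sub>k\<close> of the \<open>r\<close>-th level; it is only meaningful for
  \<open>r + k < length Q\<close>, and is only used there.\<close>

primrec de_casteljau :: "'a::real_vector list \<Rightarrow> nat \<Rightarrow> nat \<Rightarrow> 'a" where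
  "de_casteljau Q 0 k = Q ! k"
| "de_casteljau Q (Suc r) k = midpoint (de_casteljau Q r k) (de_casteljau Q r (Suc k))"

definition subdivide_left :: "'a::real_vector list \<Rightarrow> 'a list" where
  "subdivide_left Q = map (\<lambda>r. de_casteljau Q r 0) [0..<length Q]"

definition subdivide_right :: "'a::real_vector list \<Rightarrow> 'a list" where
  "subdivide_right Q = map (\<lambda>k. de_casteljau Q (length Q - 1 - k) k) [0..<length Q]"

definition subdivide :: "'a::real_vector list list \<Rightarrow> 'a list list" where
  "subdivide Qs = concat (map (\<lambda>Q. [subdivide_left Q, subdivide_right Q]) Qs)"

definition pl_curve :: "'a::real_vector list \<Rightarrow> 'a set" where
  "pl_curve Q = (\<Union>i \<in> {i. Suc i < length Q}. closed_segment (Q ! i) (Q ! Suc i))"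

definition subdivision_polygon :: "nat \<Rightarrow> 'a::real_vector list \<Rightarrow> 'a set" where
  "subdivision_polygon m P = (\<Union>Q \<in> set ((subdivide ^^ m) [P]). pl_curve Q)"

definition ambient_isotopic :: "(real^3) set \<Rightarrow> (real^3) set \<Rightarrow> bool" where
  "ambient_isotopic X Y \<longleftrightarrow>
     (\<exists>H :: (real^3) \<times> real \<Rightarrow> real^3.
        continuous_on (UNIV \<times> {0..1}) H \<and>
        (\<forall>x. H (x, 0) = x) \<and>
        (\<lambda>x. H (x, 1)) ` X = Y \<and>
        (\<forall>t\<in>{0..1}. \<exists>g. homeomorphism UNIV UNIV (\<lambda>x. H (x, t)) g))"

text \<open>Any two round circles in \<open>\<real>\<^sup>3\<close> are ambient isotopic, so one of them is fixed as the standard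
  planar circle.\<close>

definition standard_circle :: "(real^3) set" where
  "standard_circle = {x. (x $ 1)\<^sup>2 + (x $ 2)\<^sup>2 = 1 \<and> x $ 3 = 0}"

definition unknot :: "(real^3) set \<Rightarrow> bool" where
  "unknot X \<longleftrightarrow> ambient_isotopic X standard_circle"

definition control_points :: "(real^3) list" where
  "control_points =
    [vector [0, 9, 20], vector [-15, -95, -50], vector [40, 80, -20], vector [-10, -60, 58],
     vector [-60, 30, 20], vector [40, -60, -60], vector [0, 9, 20]]"

end

(* A closed curve may be moved arbitrarily along a direction u as long as its projection along u is
   injective: the displacement is then a function on the projected curve, extends to the plane by
   Tietze, and defines a shear of R^3. Such shears turn every loop with a simple closed projection,
   a piece of which is cut off by a line, into the standard circle.

   For the given control points the projection along (-7, -3, 2) is simple both for the curve and for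
   the polygon. Each piece of either lies in the convex hull of its control points and is monotone in
   every direction in which the control points increase, so simplicity follows from separating the
   planar hulls of the subdivision pieces by lines, which is integer arithmetic. *)

theory Submission
  imports Defs
begin

section \<open>Shears and ambient isotopy\<close>

text \<open>Curve and polygon are never compared directly: each is moved to the standard circle, and
  one of the two isotopies is run backwards. The obstacle is planar. To make an arbitrary simple
  closed projection round would call for the Schoenflies theorem; the line that cuts off a piece
  replaces it. Let the loop run through the cut-off piece during the second half of its parameter
  interval, and let W be the functional that is constant on the line. Then W takes different values
  at t and 1 - t for 0 < t < 1/2. Since cos (2 pi t) identifies nothing but t and 1 - t, the pair of
  W and this cosine separates the points of the loop as well as the projection does. So one
  coordinate can be replaced by a cosine while the projection is kept, and another by a sine while W
  and the cosine are kept. The cut-off piece used here consists of the fourth and fifth of the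
  sixteen subdivision pieces.\<close>

lemma ambient_isotopic_trans:
  assumes "ambient_isotopic X Y" "ambient_isotopic Y Z"
  shows "ambient_isotopic X Z"
proof -
  obtain F :: "(real^3) \<times> real \<Rightarrow> real^3"
    where F: "continuous_on (UNIV \<times> {0..1}) F" "\<forall>x. F (x, 0) = x" "(\<lambda>x. F (x, 1)) ` X = Y"
    "\<forall>t\<in>{0..1}. \<exists>g. homeomorphism UNIV UNIV (\<lambda>x. F (x, t)) g"
    using assms(1) unfolding ambient_isotopic_def by blast
  obtain G :: "(real^3) \<times> real \<Rightarrow> real^3"
    where G: "continuous_on (UNIV \<times> {0..1}) G" "\<forall>x. G (x, 0) = x" "(\<lambda>x. G (x, 1)) ` Y = Z"
    "\<forall>t\<in>{0..1}. \<exists>g. homeomorphism UNIV UNIV (\<lambda>x. G (x, t)) g"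
    using assms(2) unfolding ambient_isotopic_def by blast
  define H where "H = (\<lambda>p. if snd p \<le> 1/2 then F (fst p, 2 * snd p)
      else G (F (fst p, 1), 2 * snd p - 1))"
  have split: "(UNIV :: (real^3) set) \<times> {0..1::real} = UNIV \<times> {0..1/2} \<union> UNIV \<times> {1/2..1}"
    by auto
  have F': "continuous_on (UNIV \<times> {0..1/2::real}) (\<lambda>p. F (fst p, 2 * snd p))"
    by (rule continuous_on_compose2[OF F(1)]) (auto intro!: continuous_intros)
  have F1: "continuous_on (UNIV \<times> {1/2..1::real}) (\<lambda>p. F (fst p, 1))"
    by (rule continuous_on_compose2[OF F(1)]) (auto intro!: continuous_intros)
  have G': "continuous_on (UNIV \<times> {1/2..1::real}) (\<lambda>p. G (F (fst p, 1), 2 * snd p - 1))"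
    by (rule continuous_on_compose2[OF G(1)]) (auto intro!: continuous_intros F1)
  have "continuous_on (UNIV \<times> {0..1}) H"
    unfolding H_def split
  proof (rule continuous_on_cases)
    show "\<forall>p. p \<in> UNIV \<times> {0..1/2} \<and> \<not> snd p \<le> 1/2 \<or> p \<in> UNIV \<times> {1/2..1} \<and> snd p \<le> 1/2 \<longrightarrow>
        F (fst p, 2 * snd p) = G (F (fst p, 1), 2 * snd p - 1)"
    proof (intro allI impI)
      fix p :: "(real^3) \<times> real"
      assume "p \<in> UNIV \<times> {0..1/2} \<and> \<not> snd p \<le> 1/2 \<or> p \<in> UNIV \<times> {1/2..1} \<and> snd p \<le> 1/2"
      then have "2 * snd p = 1"
        by auto
      then show "F (fst p, 2 * snd p) = G (F (fst p, 1), 2 * snd p - 1)"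
        by (simp only: G(2) diff_self)
    qed
  qed (auto intro!: F' G' closed_Times)
  moreover have "\<forall>x. H (x, 0) = x"
    by (simp add: H_def F(2))
  moreover have "(\<lambda>x. H (x, 1)) ` X = Z"
  proof -
    have "(\<lambda>x. H (x, 1)) ` X = (\<lambda>x. G (x, 1)) ` (\<lambda>x. F (x, 1)) ` X"
      by (simp add: H_def image_image)
    then show ?thesis
      by (simp add: F(3) G(3))
  qed
  moreover have "\<exists>g. homeomorphism UNIV UNIV (\<lambda>x. H (x, t)) g" if t: "t \<in> {0..1}" for t
  proof (cases "t \<le> 1/2")
    case True
    then show ?thesis
      using bspec[OF F(4), of "2 * t"] t by (simp add: H_def)
  next
    case False
    obtain f g where "homeomorphism UNIV UNIV (\<lambda>x. F (x, 1)) f"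
      and "homeomorphism UNIV UNIV (\<lambda>x. G (x, 2 * t - 1)) g"
      using bspec[OF F(4), of 1] bspec[OF G(4), of "2 * t - 1"] False t by auto
    then have "homeomorphism UNIV UNIV ((\<lambda>x. G (x, 2 * t - 1)) \<circ> (\<lambda>x. F (x, 1))) (f \<circ> g)"
      by (rule homeomorphism_compose)
    then show ?thesis
      using False by (auto simp: H_def o_def)
  qed
  ultimately show ?thesis
    unfolding ambient_isotopic_def by blast
qed

text \<open>On a compact set \<open>g\<close> is a closed map. So \<open>d\<close>, being constant
  on the fibres of \<open>g\<close>, descends to a continuous function on the compact image of
  \<open>K\<close>, which Tietze extends.\<close>

lemma continuous_factorization:
  fixes g :: "'a::topological_space \<Rightarrow> 'b::{metric_space, second_countable_topology}"
    and d :: "'a \<Rightarrow> 'c::euclidean_space"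
  assumes "compact K" and g: "continuous_on K g" and d: "continuous_on K d"
    and fib: "\<And>s t. s \<in> K \<Longrightarrow> t \<in> K \<Longrightarrow> g s = g t \<Longrightarrow> d s = d t"
  shows "\<exists>F. continuous_on UNIV F \<and> (\<forall>t\<in>K. F (g t) = d t)"
proof -
  define f where "f y = d (SOME t. t \<in> K \<and> g t = y)" for y
  have f: "f (g t) = d t" if "t \<in> K" for t
  proof -
    let ?s = "SOME s. s \<in> K \<and> g s = g t"
    have "?s \<in> K \<and> g ?s = g t"
      by (rule someI[of _ t]) (use that in auto)
    then show ?thesis
      unfolding f_def using fib that by blast
  qed
  have "closed (g ` K \<inter> f -` B)" if "closed B" for B
  proof -
    obtain C where C: "closed C" "C \<inter> K = d -` B \<inter> K"
      using d \<open>closed B\<close> unfolding continuous_on_closed_invariant by meson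
    have "g ` K \<inter> f -` B = g ` (K \<inter> C)"
      using f C(2) by fastforce
    moreover have "compact (K \<inter> C)"
      using \<open>compact K\<close> C(1) by (rule compact_Int_closed)
    ultimately show ?thesis
      using continuous_on_subset[OF g, of "K \<inter> C"]
      by (simp add: compact_continuous_image compact_imp_closed)
  qed
  then have "continuous_on (g ` K) f"
    unfolding continuous_on_closed_invariant
    by (metis Int_assoc Int_commute Int_left_absorb)
  moreover have "closedin (top_of_set UNIV) (g ` K)"
    using compact_continuous_image[OF g \<open>compact K\<close>] by (simp add: compact_imp_closed)
  ultimately obtain F where "continuous_on UNIV F" "\<And>y. y \<in> g ` K \<Longrightarrow> F y = f y"
    by (rule Tietze_unbounded) blast
  then show ?thesis
    using f by (intro exI[of _ F]) auto
qed

text \<open>The displacement depends on \<open>L x\<close> only, and \<open>L\<close> does not see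
  motion along \<open>u\<close>. Hence each stage of the shear preserves its own displacement and is
  undone by the stage at time \<open>- t\<close>.\<close>

lemma ambient_isotopic_shear:
  fixes g :: "'a::topological_space \<Rightarrow> real^3" and L :: "real^3 \<Rightarrow> 'b::euclidean_space"
  assumes "compact K" and g: "continuous_on K g" and d: "continuous_on K d"
    and L: "linear L" "L u = 0"
    and fib: "\<And>s t. s \<in> K \<Longrightarrow> t \<in> K \<Longrightarrow> L (g s) = L (g t) \<Longrightarrow> d s = d t"
  shows "ambient_isotopic (g ` K) ((\<lambda>t. g t + d t *\<^sub>R u) ` K)"
proof -
  have contL: "continuous_on A L" for A
    using L(1) by (simp add: linear_continuous_on linear_linear)
  obtain F where F: "continuous_on UNIV F \<and> (\<forall>t\<in>K. F (L (g t)) = d t)"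
    using continuous_factorization[OF \<open>compact K\<close> continuous_on_compose2[OF contL g subset_UNIV] d] fib
    by blast
  have contF: "continuous_on A (\<lambda>x. F (L (h x)))" if "continuous_on A h" for A :: "'c::topological_space set" and h
    by (rule continuous_on_compose2[OF conjunct1[OF F] continuous_on_compose2[OF contL that subset_UNIV] subset_UNIV])
  define H where "H = (\<lambda>(x, t). x + (t * F (L x)) *\<^sub>R u)"
  have Lu: "L (x + c *\<^sub>R u) = L x" for x c
    using L by (simp add: linear_add linear_scale)
  then have Lu': "L (x - c *\<^sub>R u) = L x" for x c
    by (metis diff_add_cancel)
  have "continuous_on (UNIV \<times> {0..1}) H"
    unfolding H_def split_beta by (intro continuous_intros contF)
  moreover have "\<exists>g. homeomorphism UNIV UNIV (\<lambda>x. H (x, t)) g" for t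
    by (rule exI[of _ "\<lambda>x. H (x, - t)"], rule homeomorphismI)
      (auto simp: H_def Lu Lu' intro!: continuous_intros contF)
  moreover have "(\<lambda>x. H (x, 1)) ` g ` K = (\<lambda>t. g t + d t *\<^sub>R u) ` K"
    using F by (simp add: H_def image_image)
  ultimately show ?thesis
    unfolding ambient_isotopic_def by (intro exI[of _ H]) (auto simp: H_def)
qed

text \<open>Reversing an arbitrary ambient isotopy would need joint continuity of the inverse
  homeomorphisms in point and time. Shears are reversed by shears, so both directions are carried
  along instead.\<close>

definition mutually_isotopic :: "(real^3) set \<Rightarrow> (real^3) set \<Rightarrow> bool" where
  "mutually_isotopic X Y \<longleftrightarrow> ambient_isotopic X Y \<and> ambient_isotopic Y X"

lemma mutually_isotopic_trans [trans]:
  "mutually_isotopic X Y \<Longrightarrow> mutually_isotopic Y Z \<Longrightarrow> mutually_isotopic X Z"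
  unfolding mutually_isotopic_def using ambient_isotopic_trans by blast

text \<open>Moving along \<open>u\<close> does not change the image under \<open>L\<close>, so the
  fibre condition for \<open>g\<close> also serves the shear back, by \<open>- d\<close>.\<close>

lemma mutually_isotopic_shear:
  fixes g g' :: "'a::topological_space \<Rightarrow> real^3" and L :: "real^3 \<Rightarrow> 'b::euclidean_space"
  assumes K: "compact K" and g: "continuous_on K g" and d: "continuous_on K d"
    and L: "linear L" "L u = 0"
    and fib: "\<And>s t. s \<in> K \<Longrightarrow> t \<in> K \<Longrightarrow> L (g s) = L (g t) \<Longrightarrow> d s = d t"
    and g': "\<And>t. t \<in> K \<Longrightarrow> g' t = g t + d t *\<^sub>R u"
  shows "mutually_isotopic (g ` K) (g' ` K)"
proof -
  let ?h = "\<lambda>t. g t + d t *\<^sub>R u"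
  have Lh: "L (?h t) = L (g t)" for t
    using L by (simp add: linear_add linear_scale)
  have "ambient_isotopic (?h ` K) ((\<lambda>t. ?h t + (- d t) *\<^sub>R u) ` K)"
    using fib unfolding Lh[symmetric]
    by (intro ambient_isotopic_shear[where g = ?h and d = "\<lambda>t. - d t", OF K _ _ L] continuous_intros g d)
      simp
  moreover have "ambient_isotopic (g ` K) (?h ` K)"
    by (rule ambient_isotopic_shear[OF K g d L fib])
  moreover have "?h ` K = g' ` K"
    using g' by simp
  ultimately show ?thesis
    by (simp add: mutually_isotopic_def)
qed

lemma vector_3_eqI:
  fixes x y :: "real^3"
  assumes "x $ 1 = y $ 1" "x $ 2 = y $ 2" "x $ 3 = y $ 3"
  shows "x = y"
  using assms by (simp add: vec_eq_iff forall_3)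

lemma continuous_on_vector_3 [continuous_intros]:
  fixes f g h :: "'a::topological_space \<Rightarrow> real"
  assumes "continuous_on A f" "continuous_on A g" "continuous_on A h"
  shows "continuous_on A (\<lambda>t. vector [f t, g t, h t] :: real^3)"
proof -
  have "(\<lambda>t. vector [f t, g t, h t] :: real^3) = (\<lambda>t. f t *\<^sub>R axis 1 1 + g t *\<^sub>R axis 2 1 + h t *\<^sub>R axis 3 1)"
    by (intro ext vector_3_eqI) (simp_all add: axis_def)
  then show ?thesis
    by (simp only:) (intro continuous_intros assms)
qed

text \<open>The cosine is the second coordinate because \<open>y\<close> is the coordinate to be
  made symmetric about \<open>t = 1/2\<close>, the parameter where the two halves of the loop will
  be joined.\<close>

lemma standard_circle_eq:
  "standard_circle = (\<lambda>t. vector [sin (2 * pi * t), cos (2 * pi * t), 0]) ` {0..1}"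
proof (intro equalityI subsetI)
  fix x assume "x \<in> standard_circle"
  then have x: "(x $ 2)\<^sup>2 + (x $ 1)\<^sup>2 = 1" "x $ 3 = 0"
    by (auto simp: standard_circle_def)
  then obtain s where s: "0 \<le> s" "s < 2 * pi" "x $ 2 = cos s" "x $ 1 = sin s"
    using sincos_total_2pi by metis
  then have "x = vector [sin (2 * pi * (s / (2 * pi))), cos (2 * pi * (s / (2 * pi))), 0]"
    using x by (intro vector_3_eqI) auto
  moreover have "s / (2 * pi) \<in> {0..1}"
    using s by (auto simp: field_simps)
  ultimately show "x \<in> (\<lambda>t. vector [sin (2 * pi * t), cos (2 * pi * t), 0]) ` {0..1}"
    by (rule image_eqI)
qed (auto simp: standard_circle_def)

text \<open>The map \<open>min x (1 - x)\<close> folds the unit interval onto its first half, where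
  \<open>cos (2 * pi * x)\<close> is injective.\<close>

lemma cos_2pi_eq_imp:
  fixes s t :: real
  assumes "s \<in> {0..1}" "t \<in> {0..1}" "cos (2 * pi * s) = cos (2 * pi * t)"
  shows "t = s \<or> t = 1 - s"
proof -
  have *: "cos (2 * pi * x) = cos (2 * pi * min x (1 - x))" for x
    using cos_2pi_minus[of "2 * pi * x"] by (auto simp: min_def algebra_simps)
  have "cos (2 * pi * min s (1 - s)) = cos (2 * pi * min t (1 - t))"
    using assms(3) * by metis
  moreover have "0 \<le> 2 * pi * min x (1 - x) \<and> 2 * pi * min x (1 - x) \<le> pi" if "x \<in> {0..1}" for x :: real
  proof -
    have "pi * (2 * min x (1 - x)) \<le> pi * 1"
      by (intro mult_left_mono) (auto simp: min_def)
    then show ?thesis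
      using that by (simp add: mult_ac)
  qed
  ultimately have "2 * pi * min s (1 - s) = 2 * pi * min t (1 - t)"
    using assms(1,2) cos_inj_pi by blast
  then show ?thesis
    by (auto simp: min_def split: if_splits)
qed

lemma sincos_2pi_eq_imp:
  fixes s t :: real
  assumes "s \<in> {0..1}" "t \<in> {0..1}" "cos (2 * pi * s) = cos (2 * pi * t)" "sin (2 * pi * s) = sin (2 * pi * t)"
  shows "s = t \<or> {s, t} = {0, 1}"
proof (cases "t = s")
  case False
  then have t: "t = 1 - s"
    using cos_2pi_eq_imp assms by blast
  have "sin (2 * pi * t) = - sin (2 * pi * s)"
    using sin_2pi_minus[of "2 * pi * s"] by (simp add: t algebra_simps)
  then have "sin (2 * pi * s) = 0"
    using assms(4) by simp
  then obtain k :: int where "2 * pi * s = of_int k * pi"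
    by (auto simp: sin_zero_iff_int2)
  \<comment> \<open>Hence \<open>s\<close> is 0, 1/2 or 1, and 1/2 would give
    \<open>t = s\<close>.\<close>
  then have "2 * s = of_int k"
    by simp
  then have "k = 0 \<or> k = 1 \<or> k = 2"
    using assms(1) by (simp, linarith)
  then show ?thesis
    using \<open>2 * s = of_int k\<close> t False by auto
qed simp

text \<open>The loop is straightened by four shears. First \<open>y\<close> becomes a cosine with \<open>V\<close> and \<open>W\<close> kept, which
  is possible because \<open>(V, W)\<close> separates the points of the loop. Now \<open>(W, y)\<close> separates them as well,
  since the cosine only identifies \<open>t\<close> with \<open>1 - t\<close>; so \<open>V\<close> can be turned into a sine. Finally
  \<open>x\<close> is adjusted with \<open>(y, z)\<close> kept and \<open>z\<close> with \<open>(x, y)\<close> kept.\<close>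

lemma loop_mutually_isotopic_standard_circle:
  fixes g :: "real \<Rightarrow> real^3" and a b w1 w2 w3 :: real
  defines "V p \<equiv> a * p $ 2 + b * p $ 3" and "W p \<equiv> w1 * p $ 1 + w2 * p $ 2 + w3 * p $ 3"
  assumes "b \<noteq> 0" "w1 \<noteq> 0"
    and loop: "path g" "pathstart g = pathfinish g"
    and inj: "\<And>s t. s \<in> {0..1} \<Longrightarrow> t \<in> {0..1} \<Longrightarrow> V (g s) = V (g t) \<Longrightarrow> W (g s) = W (g t) \<Longrightarrow>
      s = t \<or> {s, t} = {0, 1}"
    and W: "\<And>t. 0 < t \<Longrightarrow> t < 1/2 \<Longrightarrow> W (g t) \<noteq> W (g (1 - t))"
  shows "mutually_isotopic (path_image g) standard_circle"
proof -
  have cg: "continuous_on {0..1} g" and ends: "g 0 = g 1"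
    using loop by (auto simp: path_def pathstart_def pathfinish_def)
  have gi: "continuous_on {0..1} (\<lambda>t. g t $ i)" for i
    by (intro continuous_intros cg)
  \<comment> \<open>\<open>u\<close> spans the common kernel of \<open>V\<close> and
    \<open>W\<close>, and \<open>e\<close> that of \<open>W\<close> and \<open>y\<close>. The
    \<open>y\<close>-coordinate of \<open>u\<close> and the value \<open>V e\<close> are both
    \<open>b\<close>, hence the divisor in \<open>d1\<close> and \<open>d2\<close>.\<close>
  define u e :: "real^3" where "u = vector [(w3 * a - w2 * b) / w1, b, - a]"
    and "e = vector [- w3 / w1, 0, 1]"
  define d1 where "d1 t = (cos (2 * pi * t) - g t $ 2) / b" for t
  define g1 where "g1 t = g t + d1 t *\<^sub>R u" for t
  define d2 where "d2 t = (sin (2 * pi * t) - V (g t)) / b" for t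
  define g2 where "g2 t = g1 t + d2 t *\<^sub>R e" for t
  define d3 where "d3 t = sin (2 * pi * t) - g2 t $ 1" for t
  \<comment> \<open>The third coordinate is what \<open>V = sin\<close> forces once \<open>y\<close>
    is the cosine.\<close>
  define g3 :: "real \<Rightarrow> real^3"
    where "g3 t = vector [sin (2 * pi * t), cos (2 * pi * t), (sin (2 * pi * t) - a * cos (2 * pi * t)) / b]" for t
  define d4 where "d4 t = - (g3 t $ 3)" for t
  define g4 :: "real \<Rightarrow> real^3" where "g4 t = vector [sin (2 * pi * t), cos (2 * pi * t), 0]" for t

  have g1: "V (g1 t) = V (g t)" "W (g1 t) = W (g t)" "g1 t $ 2 = cos (2 * pi * t)" for t
    using \<open>b \<noteq> 0\<close> \<open>w1 \<noteq> 0\<close> by (simp_all add: g1_def V_def W_def u_def d1_def) (simp_all add: field_simps)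
  have "V (g2 t) = V (g1 t) + d2 t * b" for t
    by (simp add: g2_def V_def e_def algebra_simps)
  then have g2: "V (g2 t) = sin (2 * pi * t)" "g2 t $ 2 = cos (2 * pi * t)" for t
    using \<open>b \<noteq> 0\<close> g1(1)[of t] g1(3)[of t] by (simp_all add: d2_def) (simp add: g2_def e_def)
  have g23: "g2 t $ 3 = (sin (2 * pi * t) - a * cos (2 * pi * t)) / b" for t
    using g2[of t] \<open>b \<noteq> 0\<close> by (simp add: V_def field_simps)
  have c1: "continuous_on {0..1} d1"
    unfolding d1_def by (intro continuous_intros gi) (use \<open>b \<noteq> 0\<close> in auto)
  have cg1: "continuous_on {0..1} g1"
    unfolding g1_def by (intro continuous_intros cg c1)
  have c2: "continuous_on {0..1} d2"
    unfolding d2_def V_def by (intro continuous_intros gi) (use \<open>b \<noteq> 0\<close> in auto)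
  have cg2: "continuous_on {0..1} g2"
    unfolding g2_def by (intro continuous_intros cg1 c2)
  have c3: "continuous_on {0..1} d3"
    unfolding d3_def by (intro continuous_intros cg2)
  have cg3: "continuous_on {0..1} g3"
    unfolding g3_def by (intro continuous_intros) (use \<open>b \<noteq> 0\<close> in auto)
  have c4: "continuous_on {0..1} d4"
    unfolding d4_def by (intro continuous_intros cg3)
  have lin: "linear (\<lambda>p. (V p, W p))" "linear (\<lambda>p. (W p, p $ 2))"
    "linear (\<lambda>p::real^3. (p $ 2, p $ 3))" "linear (\<lambda>p::real^3. (p $ 1, p $ 2))"
    by (rule linearI; simp add: V_def W_def algebra_simps)+
  \<comment> \<open>Separation still allows the parameters 0 and 1 to coincide; the displacements
    agree there because the loop is closed and sine and cosine are periodic.\<close>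
  have per: "d1 s = d1 t" "d2 s = d2 t" "g2 s = g2 t" if "s = t \<or> {s, t} = {0, 1}" for s t
  proof -
    have "g s = g t \<and> cos (2 * pi * s) = cos (2 * pi * t) \<and> sin (2 * pi * s) = sin (2 * pi * t)"
      using that ends by (auto simp: doubleton_eq_iff)
    then show "d1 s = d1 t" "d2 s = d2 t" "g2 s = g2 t"
      by (simp_all only: d1_def d2_def g1_def g2_def)
  qed

  have "mutually_isotopic (g ` {0..1}) (g1 ` {0..1})"
  proof (rule mutually_isotopic_shear[OF _ cg c1 lin(1)])
    show "(V u, W u) = 0"
      using \<open>w1 \<noteq> 0\<close> by (simp add: V_def W_def u_def zero_prod_def field_simps)
    show "d1 s = d1 t" if "s \<in> {0..1}" "t \<in> {0..1}" "(V (g s), W (g s)) = (V (g t), W (g t))" for s t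
      using inj[of s t] that by (intro per) blast
  qed (auto simp: g1_def)
  also have "mutually_isotopic (g1 ` {0..1}) (g2 ` {0..1})"
  proof (rule mutually_isotopic_shear[OF _ cg1 c2 lin(2)])
    show "(W e, e $ 2) = 0"
      using \<open>w1 \<noteq> 0\<close> by (simp add: W_def e_def zero_prod_def)
    show "d2 s = d2 t" if st: "s \<in> {0..1}" "t \<in> {0..1}" "(W (g1 s), g1 s $ 2) = (W (g1 t), g1 t $ 2)" for s t
    proof -
      have eq: "W (g s) = W (g t)" "cos (2 * pi * s) = cos (2 * pi * t)"
        using st(3) g1 by auto
      have "s = t \<or> {s, t} = {0, 1}"
      proof (cases "t = s")
        case False
        \<comment> \<open>Unless the pair is 0 and 1, one of \<open>s\<close> and
          \<open>1 - s\<close> lies strictly between 0 and 1/2, where the hypothesis on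
          \<open>W\<close> forbids equal values.\<close>
        then have "t = 1 - s"
          using cos_2pi_eq_imp[OF st(1,2) eq(2)] by simp
        then have "\<not> (0 < s \<and> s < 1/2)" "\<not> (0 < t \<and> t < 1/2)"
          using W[of s] W[of t] eq(1) by auto
        then show ?thesis
          using st(1,2) False \<open>t = 1 - s\<close> by auto
      qed simp
      then show ?thesis
        by (rule per)
    qed
  qed (auto simp: g2_def)
  also have "mutually_isotopic (g2 ` {0..1}) (g3 ` {0..1})"
  proof (rule mutually_isotopic_shear[OF _ cg2 c3 lin(3)])
    show "d3 s = d3 t" if st: "s \<in> {0..1}" "t \<in> {0..1}" "(g2 s $ 2, g2 s $ 3) = (g2 t $ 2, g2 t $ 3)" for s t
    proof -
      have "V (g2 s) = V (g2 t)"
        using st(3) by (simp add: V_def)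
      then have "s = t \<or> {s, t} = {0, 1}"
        using st g2 by (intro sincos_2pi_eq_imp) auto
      then have "g2 s = g2 t"
        by (rule per)
      then show ?thesis
        by (simp only: d3_def flip: g2(1))
    qed
    show "g3 t = g2 t + d3 t *\<^sub>R axis 1 1" for t
      by (rule vector_3_eqI) (simp_all add: g3_def d3_def axis_def g2(2) g23)
  qed (simp_all add: axis_def zero_prod_def)
  also have "mutually_isotopic (g3 ` {0..1}) (g4 ` {0..1})"
  proof (rule mutually_isotopic_shear[OF _ cg3 c4 lin(4)])
    show "d4 s = d4 t" if "(g3 s $ 1, g3 s $ 2) = (g3 t $ 1, g3 t $ 2)" for s t
      using that by (simp add: d4_def g3_def)
    show "g4 t = g3 t + d4 t *\<^sub>R axis 3 1" for t
      by (rule vector_3_eqI) (simp_all add: g3_def g4_def d4_def axis_def)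
  qed (simp_all add: axis_def zero_prod_def)
  finally show ?thesis
    by (simp add: path_image_def standard_circle_eq g4_def)
qed

section \<open>Chains of paths with separated control points\<close>

fun join_list :: "(real \<Rightarrow> 'a::topological_space) list \<Rightarrow> real \<Rightarrow> 'a" where
  "join_list [p] = p"
| "join_list (p # q # ps) = p +++ join_list (q # ps)"

abbreviation consecutive :: "(real \<Rightarrow> 'a::topological_space) list \<Rightarrow> bool" where
  "consecutive \<equiv> successively (\<lambda>p q. pathfinish p = pathstart q)"

lemma pathstart_join_list: "ps \<noteq> [] \<Longrightarrow> pathstart (join_list ps) = pathstart (hd ps)"
  by (induction ps rule: join_list.induct) auto

lemma pathfinish_join_list: "ps \<noteq> [] \<Longrightarrow> pathfinish (join_list ps) = pathfinish (last ps)"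
  by (induction ps rule: join_list.induct) auto

lemma path_image_join_list:
  "ps \<noteq> [] \<Longrightarrow> consecutive ps \<Longrightarrow> path_image (join_list ps) = (\<Union>p \<in> set ps. path_image p)"
  by (induction ps rule: join_list.induct) (auto simp: path_image_join pathstart_join_list)

lemma path_join_list:
  "ps \<noteq> [] \<Longrightarrow> consecutive ps \<Longrightarrow> \<forall>p \<in> set ps. path p \<Longrightarrow> path (join_list ps)"
  by (induction ps rule: join_list.induct) (auto simp: pathstart_join_list)

lemma join_list_compose:
  "ps \<noteq> [] \<Longrightarrow> f \<circ> join_list ps = join_list (map (\<lambda>p. f \<circ> p) ps)"
  by (induction ps rule: join_list.induct) (auto simp: path_compose_join)

text \<open>Both a Bezier curve and the polygonal path through its control points follow the list of
  control points in this sense, so that one certificate about control points serves both.\<close>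

definition follows :: "(real \<Rightarrow> 'a::euclidean_space) \<Rightarrow> 'a list \<Rightarrow> bool" where
  "follows p Q \<longleftrightarrow> path p \<and> pathstart p = hd Q \<and> pathfinish p = last Q \<and>
     path_image p \<subseteq> convex hull (set Q) \<and>
     (\<forall>f :: 'a \<Rightarrow> real. linear f \<longrightarrow> sorted_wrt (<) (map f Q) \<longrightarrow> inj_on (f \<circ> p) {0..1})"

text \<open>A functional on the target becomes one on the source after composition with
  \<open>L\<close>. This brings paths in space down to the plane in which the certificates are
  checked.\<close>

lemma follows_linear_image:
  fixes L :: "'a::euclidean_space \<Rightarrow> 'b::euclidean_space"
  assumes "follows p Q" "linear L" "Q \<noteq> []"
  shows "follows (L \<circ> p) (map L Q)"
  unfolding follows_def
proof (intro conjI allI impI)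
  show "path (L \<circ> p)"
    using assms by (intro path_continuous_image) (auto simp: follows_def linear_continuous_on linear_linear)
  show "pathstart (L \<circ> p) = hd (map L Q)" "pathfinish (L \<circ> p) = last (map L Q)"
    using assms by (auto simp: follows_def pathstart_compose pathfinish_compose hd_map last_map)
  show "path_image (L \<circ> p) \<subseteq> convex hull (set (map L Q))"
    using assms by (simp add: follows_def path_image_compose image_mono flip: convex_hull_linear_image)
  show "inj_on (f \<circ> (L \<circ> p)) {0..1}" if "linear f" "sorted_wrt (<) (map f (map L Q))" for f :: "'b \<Rightarrow> real"
    using assms linear_compose[OF \<open>linear L\<close> that(1)] that(2)
    by (auto simp: follows_def o_assoc o_def)
qed

section \<open>Separation of convex hulls by lines, and integer certificates for it\<close>

lemma convex_hull_inner_less: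
  fixes d :: "'a::euclidean_space"
  assumes "\<And>x. x \<in> S \<Longrightarrow> d \<bullet> x < c" "x \<in> convex hull S"
  shows "d \<bullet> x < c"
proof -
  have "convex hull S \<subseteq> {x. d \<bullet> x < c}"
    using assms(1) by (intro hull_minimal convex_halfspace_lt) auto
  then show ?thesis
    using assms(2) by auto
qed

lemma convex_hull_inner_le:
  fixes d :: "'a::euclidean_space"
  assumes "\<And>x. x \<in> S \<Longrightarrow> d \<bullet> x \<le> c" "x \<in> convex hull S"
  shows "d \<bullet> x \<le> c"
proof -
  have "convex hull S \<subseteq> {x. d \<bullet> x \<le> c}"
    using assms(1) by (intro hull_minimal convex_halfspace_le) auto
  then show ?thesis
    using assms(2) by auto
qed

text \<open>Write \<open>x\<close> as a convex combination of \<open>P\<close> and a point of the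
  hull of \<open>S\<close>: any positive weight on the latter would push
  \<open>d \<bullet> x\<close> below \<open>d \<bullet> P\<close>.\<close>

lemma convex_hull_exposed_point:
  fixes d :: "'a::euclidean_space"
  assumes S: "\<And>x. x \<in> S \<Longrightarrow> d \<bullet> x < d \<bullet> P" and x: "x \<in> convex hull (insert P S)" "d \<bullet> P \<le> d \<bullet> x"
  shows "x = P"
proof (cases "S = {}")
  case False
  then obtain u v y where uv: "u \<ge> 0" "v \<ge> 0" "u + v = 1" "y \<in> convex hull S" "x = u *\<^sub>R P + v *\<^sub>R y"
    using x(1) by (auto simp: convex_hull_insert)
  have "d \<bullet> y < d \<bullet> P"
    using convex_hull_inner_less[OF S uv(4)] .
  moreover have "v * (d \<bullet> P) \<le> v * (d \<bullet> y)"
  proof -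
    have "u = 1 - v"
      using uv by simp
    then have "d \<bullet> x = (1 - v) * (d \<bullet> P) + v * (d \<bullet> y)"
      using uv(5) by (simp add: inner_add_right)
    then show ?thesis
      using x(2) by (simp add: algebra_simps)
  qed
  ultimately have "v = 0"
    using uv(2) by (metis mult_le_cancel_left_pos not_less order_le_less)
  then show ?thesis
    using uv by simp
qed (use x in auto)

text \<open>The certificates live on pairs of integers, so that evaluation decides them;
  \<open>real_pt\<close> transfers them to the real plane.\<close>

fun dot :: "int \<times> int \<Rightarrow> int \<times> int \<Rightarrow> int" where
  "dot (a, b) (x, y) = a * x + b * y"

definition real_pt :: "int \<times> int \<Rightarrow> real \<times> real" where
  "real_pt p = (of_int (fst p), of_int (snd p))"

lemma inner_real_pt: "real_pt d \<bullet> real_pt p = of_int (dot d p)"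
  by (cases d; cases p) (simp add: real_pt_def)

definition ascending :: "int \<times> int \<Rightarrow> (int \<times> int) list \<Rightarrow> bool" where
  "ascending d Q \<longleftrightarrow> successively (<) (map (dot d) Q)"

definition below :: "int \<times> int \<Rightarrow> (int \<times> int) list \<Rightarrow> (int \<times> int) list \<Rightarrow> bool" where
  "below d Q R \<longleftrightarrow> Max (set (map (dot d) Q)) < Min (set (map (dot d) R))"

text \<open>The line through the common point, normal to \<open>d\<close>, has the rest of
  \<open>Q\<close> strictly on one side and the rest of \<open>R\<close> strictly on the
  other.\<close>

definition touching :: "int \<times> int \<Rightarrow> (int \<times> int) list \<Rightarrow> (int \<times> int) list \<Rightarrow> bool" where
  "touching d Q R \<longleftrightarrow> last Q = hd R \<and> (\<forall>p \<in> set (butlast Q). dot d p < dot d (hd R)) \<and>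
     (\<forall>p \<in> set (tl R). dot d (hd R) < dot d p)"

text \<open>Injectivity of each piece, a single common point for neighbours, disjointness for all
  other pairs. A direction from \<open>D\<close> may prove disjointness either way round, whereas
  the other two tests respect the order of traversal.\<close>

fun arc_certificate :: "(int \<times> int) list \<Rightarrow> (int \<times> int) list list \<Rightarrow> bool" where
  "arc_certificate D [] = True"
| "arc_certificate D [Q] = (\<exists>d \<in> set D. ascending d Q)"
| "arc_certificate D (Q # R # Qs) =
     ((\<exists>d \<in> set D. ascending d Q) \<and> (\<exists>d \<in> set D. touching d Q R) \<and>
      (\<forall>S \<in> set Qs. \<exists>d \<in> set D. below d Q S \<or> below d S Q) \<and> arc_certificate D (R # Qs))"

lemma follows_ascending_imp_arc:
  assumes "follows p (map real_pt Q)" "ascending d Q"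
  shows "arc p"
proof -
  let ?f = "\<lambda>x. real_pt d \<bullet> x"
  have "sorted_wrt (<) (map (dot d) Q)"
    using assms(2) by (simp add: ascending_def successively_conv_sorted_wrt)
  then have "sorted_wrt (<) (map ?f (map real_pt Q))"
    by (simp add: sorted_wrt_map inner_real_pt)
  moreover have "linear ?f"
    by (simp add: bounded_linear.linear bounded_linear_inner_right)
  ultimately have "inj_on (?f \<circ> p) {0..1}"
    using assms(1) by (auto simp: follows_def)
  then have "inj_on p {0..1}"
    by (rule inj_on_imageI2)
  then show ?thesis
    using assms(1) by (simp add: arc_def follows_def)
qed

lemma follows_below_disjoint:
  assumes "follows p (map real_pt Q)" "follows q (map real_pt R)" "below d Q R"
  shows "path_image p \<inter> path_image q = {}"
proof (rule ccontr)
  assume "path_image p \<inter> path_image q \<noteq> {}"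
  then obtain x where "x \<in> path_image p" "x \<in> path_image q"
    by blast
  then have x: "x \<in> convex hull (real_pt ` set Q)" "x \<in> convex hull (real_pt ` set R)"
    using assms(1,2) by (auto simp: follows_def)
  have "real_pt d \<bullet> x \<le> of_int (Max (set (map (dot d) Q)))"
    by (rule convex_hull_inner_le[OF _ x(1)]) (auto simp: inner_real_pt)
  moreover have "(- real_pt d) \<bullet> x \<le> - of_int (Min (set (map (dot d) R)))"
    by (rule convex_hull_inner_le[OF _ x(2)]) (auto simp: inner_real_pt)
  ultimately show False
    using assms(3) by (simp add: below_def)
qed

text \<open>The shared point is the exposed maximum of the hull of \<open>Q\<close> and the exposed
  minimum of the hull of \<open>R\<close> in direction \<open>d\<close>. A common point on or above
  its level is pinned down by the first hull, one below it by the second.\<close>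

lemma follows_touching_Int:
  assumes "follows p (map real_pt Q)" "follows q (map real_pt R)" "touching d Q R" "Q \<noteq> []" "R \<noteq> []"
  shows "path_image p \<inter> path_image q \<subseteq> {pathstart q}"
proof
  fix x assume "x \<in> path_image p \<inter> path_image q"
  then have x: "x \<in> convex hull (real_pt ` set Q)" "x \<in> convex hull (real_pt ` set R)"
    using assms(1,2) by (auto simp: follows_def)
  let ?P = "real_pt (hd R)"
  have Q: "real_pt ` set Q = insert ?P (real_pt ` set (butlast Q))"
    using assms(3,4) by (metis append_butlast_last_id image_insert insert_is_Un list.simps(15)
        set_append sup_commute touching_def empty_set)
  have R: "real_pt ` set R = insert ?P (real_pt ` set (tl R))"
    using assms(5) by (cases R) auto
  have "x = ?P"
  proof (cases "real_pt d \<bullet> ?P \<le> real_pt d \<bullet> x")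
    case True
    show ?thesis
      by (rule convex_hull_exposed_point[OF _ _ True, of "real_pt ` set (butlast Q)"])
        (use x Q assms(3) in \<open>auto simp: touching_def inner_real_pt\<close>)
  next
    case False
    show ?thesis
      by (rule convex_hull_exposed_point[of "real_pt ` set (tl R)" "- real_pt d"])
        (use x R False assms(3) in \<open>auto simp: touching_def inner_real_pt\<close>)
  qed
  then show "x \<in> {pathstart q}"
    using assms(2,5) by (simp add: follows_def hd_map)
qed

text \<open>The first path meets its neighbour only at the joint and no later path at all, so it can
  be attached to the arc formed by the rest.\<close>

lemma arc_join_list:
  assumes "list_all2 (\<lambda>p Q. follows p (map real_pt Q)) ps Qs" "arc_certificate D Qs"
    "[] \<notin> set Qs" "Qs \<noteq> []"
  shows "arc (join_list ps) \<and> consecutive ps"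
  using assms
proof (induction ps arbitrary: Qs rule: join_list.induct)
  case (1 p)
  then show ?case
    using follows_ascending_imp_arc by (auto simp: list_all2_Cons1)
next
  case (2 p q ps)
  then obtain Q R Qs' where Qs: "Qs = Q # R # Qs'"
    and p: "follows p (map real_pt Q)" and q: "follows q (map real_pt R)"
    and ps: "list_all2 (\<lambda>p Q. follows p (map real_pt Q)) ps Qs'"
    by (auto simp: list_all2_Cons1)
  have IH: "arc (join_list (q # ps))" "consecutive (q # ps)"
    using "2.IH"[of "R # Qs'"] "2.prems" Qs by auto
  have "arc p"
    using "2.prems" Qs p follows_ascending_imp_arc by auto
  have touch: "path_image p \<inter> path_image q \<subseteq> {pathstart q}"
    using "2.prems" Qs follows_touching_Int[OF p q] by auto
  have fin: "pathfinish p = pathstart q"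
    using "2.prems" Qs p q by (auto simp: follows_def touching_def hd_map last_map)
  have disj: "path_image p \<inter> path_image r = {}" if r: "r \<in> set ps" for r
  proof -
    obtain i where "i < length ps" "r = ps ! i"
      using r by (auto simp: in_set_conv_nth)
    then have "Qs' ! i \<in> set Qs'" "follows r (map real_pt (Qs' ! i))"
      using ps by (auto simp: list_all2_conv_all_nth)
    moreover from this have "\<exists>d \<in> set D. below d Q (Qs' ! i) \<or> below d (Qs' ! i) Q"
      using "2.prems"(2) Qs by simp
    ultimately show ?thesis
      using follows_below_disjoint p by blast
  qed
  have "path_image p \<inter> path_image (join_list (q # ps)) \<subseteq> {pathstart q}"
    using touch disj by (subst path_image_join_list) (use IH in auto)
  then have "arc (join_list (p # q # ps))"
    using \<open>arc p\<close> IH fin by (simp add: arc_join pathstart_join_list)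
  then show ?case
    using IH fin by simp
qed auto

text \<open>The lists \<open>B1\<close>, \<open>B2\<close> lie on one side of the line \<open>w = const\<close> through the two outer end points of
  their chain, and \<open>As\<close> on the other. With \<open>W\<close> the functional \<open>w\<close>, this is the condition
  \<open>W (g t) \<noteq> W (g (1 - t))\<close> of the preceding lemma on loops.\<close>

definition cap_certificate ::
  "int \<times> int \<Rightarrow> (int \<times> int) list list \<Rightarrow> (int \<times> int) list \<Rightarrow> (int \<times> int) list \<Rightarrow> bool" where
  "cap_certificate w As B1 B2 \<longleftrightarrow>
     (\<forall>Q \<in> set As. \<forall>p \<in> set Q. dot w (hd B1) \<le> dot w p) \<and> dot w (last B2) = dot w (hd B1) \<and>
     (\<forall>p \<in> set (tl B1) \<union> set (butlast B2). dot w p < dot w (hd B1))"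

text \<open>To be applied to the first piece of the cap, which reaches its line only at the outer
  end point; \<open>follows_exposed_finish\<close> does the same for the last piece.\<close>

lemma follows_exposed_start:
  assumes "follows p (map real_pt Q)" "Q \<noteq> []" "\<And>x. x \<in> set (tl Q) \<Longrightarrow> dot d x < dot d (hd Q)"
    and x: "x \<in> path_image p" "of_int (dot d (hd Q)) \<le> real_pt d \<bullet> x"
  shows "x = pathstart p"
proof -
  have Q: "real_pt ` set Q = insert (real_pt (hd Q)) (real_pt ` set (tl Q))"
    using assms(2) by (cases Q) auto
  have "x \<in> convex hull (real_pt ` set Q)"
    using assms(1) x by (auto simp: follows_def)
  then have "x = real_pt (hd Q)"
    using assms x unfolding Q
    by (intro convex_hull_exposed_point[of "real_pt ` set (tl Q)" "real_pt d"]) (auto simp: inner_real_pt)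
  then show ?thesis
    using assms by (simp add: follows_def hd_map)
qed

lemma follows_exposed_finish:
  assumes "follows p (map real_pt Q)" "Q \<noteq> []" "\<And>x. x \<in> set (butlast Q) \<Longrightarrow> dot d x < dot d (last Q)"
    and x: "x \<in> path_image p" "of_int (dot d (last Q)) \<le> real_pt d \<bullet> x"
  shows "x = pathfinish p"
proof -
  have Q: "real_pt ` set Q = insert (real_pt (last Q)) (real_pt ` set (butlast Q))"
    using assms(2) by (cases Q rule: rev_cases) auto
  have "x \<in> convex hull (real_pt ` set Q)"
    using assms(1) x by (auto simp: follows_def)
  then have "x = real_pt (last Q)"
    using assms x unfolding Q
    by (intro convex_hull_exposed_point[of "real_pt ` set (butlast Q)" "real_pt d"]) (auto simp: inner_real_pt)
  then show ?thesis
    using assms by (simp add: follows_def last_map)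
qed

text \<open>The chain \<open>ps\<close> projects into the closed half plane
  \<open>c \<le> W\<close>, and the cap reaches that half plane only at its two end points. This
  gives both the simplicity of the projected loop and the condition that \<open>W\<close> differs at
  \<open>t\<close> and \<open>1 - t\<close>.\<close>

lemma closed_chain_mutually_isotopic_standard_circle:
  fixes ps :: "(real \<Rightarrow> real^3) list" and a b c1 c2 c3 :: real
  defines "L \<equiv> \<lambda>p::real^3. (a * p $ 2 + b * p $ 3, c1 * p $ 1 + c2 * p $ 2 + c3 * p $ 3)"
  assumes "b \<noteq> 0" "c1 \<noteq> 0" "snd w \<noteq> 0"
    and paths: "\<forall>p \<in> set (q1 # q2 # ps). path p"
    and A: "list_all2 (\<lambda>p Q. follows (L \<circ> p) (map real_pt Q)) ps As" "arc_certificate D As"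
      "[] \<notin> set As" "As \<noteq> []"
    and B: "follows (L \<circ> q1) (map real_pt B1)" "follows (L \<circ> q2) (map real_pt B2)"
      "arc_certificate D [B1, B2]" "B1 \<noteq> []" "B2 \<noteq> []"
    and closed: "consecutive (ps @ [q1, q2])" "pathfinish q2 = pathstart (hd ps)"
    and cap: "cap_certificate w As B1 B2"
  shows "mutually_isotopic (\<Union>p \<in> set (q1 # q2 # ps). path_image p) standard_circle"
proof -
  have "ps \<noteq> []"
    using A by auto
  have cons: "consecutive ps" "pathfinish q1 = pathstart q2" "pathfinish (last ps) = pathstart q1"
    using closed(1) \<open>ps \<noteq> []\<close> by (auto simp: successively_append_iff)
  let ?p = "join_list ps" and ?q = "q1 +++ q2"
  \<comment> \<open>This order puts the cap on the second half, so that \<open>1 - t\<close> is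
    inside the cap whenever \<open>0 < t < 1/2\<close>.\<close>
  define g where "g = ?p +++ ?q"
  have path: "path ?p" "path ?q"
    using paths cons \<open>ps \<noteq> []\<close> by (auto simp: path_join_list)
  have ends: "pathfinish ?p = pathstart ?q" "pathfinish ?q = pathstart ?p"
    using cons closed(2) \<open>ps \<noteq> []\<close> by (auto simp: pathfinish_join_list pathstart_join_list)
  have "path g" "pathstart g = pathfinish g"
    using path ends by (auto simp: g_def)
  have image: "path_image g = (\<Union>p \<in> set (q1 # q2 # ps). path_image p)"
    using path ends cons \<open>ps \<noteq> []\<close>
    by (auto simp: g_def path_image_join path_image_join_list)

  have Lp: "L \<circ> ?p = join_list (map (\<lambda>p. L \<circ> p) ps)" and Lq: "L \<circ> ?q = (L \<circ> q1) +++ (L \<circ> q2)"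
    using \<open>ps \<noteq> []\<close> by (auto simp: join_list_compose path_compose_join)
  have arcs: "arc (L \<circ> ?p)" "arc (L \<circ> ?q)"
    using arc_join_list[of "map (\<lambda>p. L \<circ> p) ps" As D] arc_join_list[of "[L \<circ> q1, L \<circ> q2]" "[B1, B2]" D] A B
    unfolding Lp Lq by (simp_all add: list_all2_map1)
  have Lends: "pathfinish (L \<circ> ?p) = pathstart (L \<circ> ?q)" "pathfinish (L \<circ> ?q) = pathstart (L \<circ> ?p)"
    using ends by (simp_all add: pathstart_compose pathfinish_compose)
  define W where "W x = real_pt w \<bullet> x" for x
  define c :: real where "c = of_int (dot w (hd B1))"
  have above: "c \<le> W x" if x: "x \<in> path_image (L \<circ> ?p)" for x
  proof -
    obtain p where "p \<in> set ps" "x \<in> path_image (L \<circ> p)"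
      using x cons \<open>ps \<noteq> []\<close> by (auto simp: path_image_compose path_image_join_list)
    then obtain Q where Q: "Q \<in> set As" "x \<in> convex hull (real_pt ` set Q)"
      using A(1) by (fastforce simp: list_all2_conv_all_nth in_set_conv_nth follows_def)
    have "(- real_pt w) \<bullet> x \<le> - c"
      by (rule convex_hull_inner_le[OF _ Q(2)])
        (use cap Q(1) in \<open>auto simp: c_def inner_real_pt cap_certificate_def\<close>)
    then show ?thesis
      by (simp add: W_def)
  qed
  have under: "x \<in> {pathstart (L \<circ> ?q), pathfinish (L \<circ> ?q)}"
    if x: "x \<in> path_image (L \<circ> ?q)" "c \<le> W x" for x
  proof -
    consider "x \<in> path_image (L \<circ> q1)" | "x \<in> path_image (L \<circ> q2)"
      using x(1) cons by (auto simp: path_image_compose path_image_join)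
    then show ?thesis
    proof cases
      case 1
      have "x = pathstart (L \<circ> q1)"
        by (rule follows_exposed_start[OF B(1,4) _ 1, of w])
          (use cap x in \<open>auto simp: cap_certificate_def c_def W_def\<close>)
      then show ?thesis
        by (simp add: pathstart_compose)
    next
      case 2
      have "x = pathfinish (L \<circ> q2)"
        by (rule follows_exposed_finish[OF B(2,5) _ 2, of w])
          (use cap x in \<open>auto simp: cap_certificate_def c_def W_def\<close>)
      then show ?thesis
        by (simp add: pathfinish_compose)
    qed
  qed
  have simple: "simple_path (L \<circ> g)"
  proof -
    have "path_image (L \<circ> ?p) \<inter> path_image (L \<circ> ?q) \<subseteq> {pathstart (L \<circ> ?p), pathstart (L \<circ> ?q)}"
      using above under Lends by blast
    from simple_path_join_loop[OF arcs Lends this] show ?thesis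
      by (simp only: g_def path_compose_join)
  qed

  \<comment> \<open>The coefficients of \<open>W \<circ> L\<close> as a functional on space. As
    \<open>snd w \<noteq> 0\<close>, \<open>w1\<close> does not vanish and the first coordinate of
    \<open>L\<close> together with \<open>W\<close> determines \<open>L\<close>.\<close>
  define w1 w2 w3 where "w1 = real_of_int (snd w) * c1"
    and "w2 = real_of_int (fst w) * a + real_of_int (snd w) * c2"
    and "w3 = real_of_int (fst w) * b + real_of_int (snd w) * c3"
  have WL: "W (L x) = w1 * x $ 1 + w2 * x $ 2 + w3 * x $ 3" for x
    by (simp add: W_def L_def real_pt_def w1_def w2_def w3_def algebra_simps)
  have "mutually_isotopic (path_image g) standard_circle"
  proof (rule loop_mutually_isotopic_standard_circle[of b w1 g a w2 w3, folded WL])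
    show "s = t \<or> {s, t} = {0, 1}"
      if st: "s \<in> {0..1}" "t \<in> {0..1}" "a * g s $ 2 + b * g s $ 3 = a * g t $ 2 + b * g t $ 3"
        "W (L (g s)) = W (L (g t))" for s t
    proof -
      have "L (g s) = L (g t)"
        using st(3,4) \<open>snd w \<noteq> 0\<close> by (simp add: W_def L_def real_pt_def)
      then have "s = t \<or> s = 0 \<and> t = 1 \<or> s = 1 \<and> t = 0"
        using simple st(1,2) unfolding simple_path_def loop_free_def o_apply by blast
      then show ?thesis
        by auto
    qed
    show "W (L (g t)) \<noteq> W (L (g (1 - t)))" if t: "0 < t" "t < 1/2" for t
    proof
      assume eq: "W (L (g t)) = W (L (g (1 - t)))"
      have "L (g t) \<in> path_image (L \<circ> ?p)"
        using t by (auto simp: g_def joinpaths_def path_image_def)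
      then have ge: "c \<le> W (L (g (1 - t)))"
        using above eq by fastforce
      \<comment> \<open>In the second half the parameter \<open>1 - t\<close> becomes
        \<open>2 * (1 - t) - 1\<close>.\<close>
      have q: "L (g (1 - t)) = (L \<circ> ?q) (1 - 2 * t)"
        using t by (simp add: g_def joinpaths_def[of ?p] algebra_simps)
      then have "L (g (1 - t)) \<in> path_image (L \<circ> ?q)"
        using t by (auto simp: path_image_def)
      then have "(L \<circ> ?q) (1 - 2 * t) = (L \<circ> ?q) 0 \<or> (L \<circ> ?q) (1 - 2 * t) = (L \<circ> ?q) 1"
        using under ge unfolding q by (fastforce simp: pathstart_def pathfinish_def)
      moreover have "inj_on (L \<circ> ?q) {0..1}"
        using arcs(2) by (simp add: arc_def)
      moreover have "1 - 2 * t \<in> {0..1}" "(0::real) \<in> {0..1}" "(1::real) \<in> {0..1}"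
        using t by auto
      ultimately have "1 - 2 * t = 0 \<or> 1 - 2 * t = 1"
        by (meson inj_onD)
      then show False
        using t by simp
    qed
  qed (use assms \<open>path g\<close> \<open>pathstart g = pathfinish g\<close> in \<open>auto simp: w1_def\<close>)
  then show ?thesis
    by (simp only: image)
qed

section \<open>Bezier curves and subdivision\<close>

text \<open>With the degree separate and the coefficients a function on the naturals, an induction
  can pass to \<open>q\<close> and to its shift without surgery on lists.\<close>

definition bernstein_sum :: "nat \<Rightarrow> (nat \<Rightarrow> 'a::real_normed_vector) \<Rightarrow> real \<Rightarrow> 'a" where
  "bernstein_sum n q t = (\<Sum>i\<le>n. Bernstein n i t *\<^sub>R q i)"

lemma bezier_eq_bernstein_sum: "bezier Q t = bernstein_sum (length Q - 1) (\<lambda>i. Q ! i) t"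
  by (simp add: bezier_def bernstein_sum_def atLeast0AtMost)

lemma bernstein_sum_cong: "(\<And>i. i \<le> n \<Longrightarrow> q i = r i) \<Longrightarrow> bernstein_sum n q t = bernstein_sum n r t"
  by (simp add: bernstein_sum_def)

lemma Bernstein_0_Suc: "Bernstein (Suc n) 0 t = (1 - t) * Bernstein n 0 t"
  by (simp add: Bernstein_def)

lemma Bernstein_Suc_Suc: "Bernstein (Suc n) (Suc k) t = (1 - t) * Bernstein n (Suc k) t + t * Bernstein n k t"
proof (cases "k < n")
  case True
  then have "(1 - t) ^ (n - k) = (1 - t) * (1 - t) ^ (n - Suc k)"
    by (metis Suc_diff_Suc power_Suc)
  note e = this
  show ?thesis
    by (simp add: Bernstein_def e algebra_simps)
qed (auto simp: Bernstein_def algebra_simps not_less)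

lemma bernstein_sum_0 [simp]: "bernstein_sum 0 q t = q 0"
  by (simp add: bernstein_sum_def Bernstein_def)

text \<open>All facts about Bezier curves below are inductions along this de Casteljau recursion.\<close>

lemma bernstein_sum_Suc:
  "bernstein_sum (Suc n) q t = (1 - t) *\<^sub>R bernstein_sum n q t + t *\<^sub>R bernstein_sum n (\<lambda>i. q (Suc i)) t"
proof -
  \<comment> \<open>The extra term is zero, because \<open>Bernstein n (Suc n)\<close> vanishes; now
    both sums can be shifted alike.\<close>
  have "bernstein_sum n q t = (\<Sum>i\<le>Suc n. Bernstein n i t *\<^sub>R q i)"
    by (simp add: bernstein_sum_def Bernstein_def)
  also have "\<dots> = Bernstein n 0 t *\<^sub>R q 0 + (\<Sum>i\<le>n. Bernstein n (Suc i) t *\<^sub>R q (Suc i))"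
    by (rule sum.atMost_Suc_shift)
  finally have *: "bernstein_sum n q t = \<dots>" .
  have "bernstein_sum (Suc n) q t =
      Bernstein (Suc n) 0 t *\<^sub>R q 0 + (\<Sum>i\<le>n. Bernstein (Suc n) (Suc i) t *\<^sub>R q (Suc i))"
    unfolding bernstein_sum_def by (rule sum.atMost_Suc_shift)
  also have "\<dots> = (1 - t) *\<^sub>R bernstein_sum n q t + t *\<^sub>R bernstein_sum n (\<lambda>i. q (Suc i)) t"
    unfolding *
    by (simp add: Bernstein_0_Suc Bernstein_Suc_Suc bernstein_sum_def[of n "\<lambda>i. q (Suc i)"]
        scaleR_left_distrib sum.distrib scaleR_right_distrib scaleR_sum_right)
  finally show ?thesis .
qed

lemma bernstein_sum_at_0 [simp]: "bernstein_sum n q 0 = q 0"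
  by (induction n arbitrary: q) (auto simp: bernstein_sum_Suc)

lemma bernstein_sum_at_1 [simp]: "bernstein_sum n q 1 = q n"
  by (induction n arbitrary: q) (auto simp: bernstein_sum_Suc)

lemma bernstein_sum_in_convex_hull:
  assumes "t \<in> {0..1}"
  shows "bernstein_sum n q t \<in> convex hull (q ` {..n})"
proof (induction n arbitrary: q)
  case (Suc n)
  have "bernstein_sum n q t \<in> convex hull (q ` {..Suc n})"
    by (rule subsetD[OF hull_mono Suc]) auto
  moreover have "bernstein_sum n (\<lambda>i. q (Suc i)) t \<in> convex hull (q ` {..Suc n})"
    by (rule subsetD[OF hull_mono Suc]) auto
  ultimately show ?case
    using assms unfolding bernstein_sum_Suc by (intro convexD[OF convex_convex_hull]) auto
qed auto

lemma bernstein_sum_strict_mono_coeffs: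
  fixes q r :: "nat \<Rightarrow> real"
  assumes "\<And>i. i \<le> n \<Longrightarrow> q i < r i" "t \<in> {0..1}"
  shows "bernstein_sum n q t < bernstein_sum n r t"
  using assms(1)
proof (induction n arbitrary: q r)
  case (Suc n)
  have "bernstein_sum n q t < bernstein_sum n r t"
    "bernstein_sum n (\<lambda>i. q (Suc i)) t < bernstein_sum n (\<lambda>i. r (Suc i)) t"
    using Suc by auto
  \<comment> \<open>For \<open>t > 0\<close> the second summand is strictly increased; at
    \<open>t = 0\<close> only the first is left.\<close>
  then show ?case
    using assms(2) unfolding bernstein_sum_Suc
    by (cases "t = 0") (auto intro!: add_le_less_mono mult_left_mono mult_strict_left_mono)
qed auto

text \<open>A product rule for differences, in place of the derivative: the first term is the change
  of the weights, the others are the changes of the two sums of lower degree. For increasing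
  coefficients and \<open>s < t\<close> the first is positive and the others are
  nonnegative.\<close>

lemma bernstein_sum_increment:
  fixes q :: "nat \<Rightarrow> real"
  shows "bernstein_sum (Suc n) q t - bernstein_sum (Suc n) q s =
    (t - s) * (bernstein_sum n (\<lambda>i. q (Suc i)) s - bernstein_sum n q s) +
    (1 - t) * (bernstein_sum n q t - bernstein_sum n q s) +
    t * (bernstein_sum n (\<lambda>i. q (Suc i)) t - bernstein_sum n (\<lambda>i. q (Suc i)) s)"
  by (simp add: bernstein_sum_Suc algebra_simps)

lemma bernstein_sum_mono:
  fixes q :: "nat \<Rightarrow> real"
  assumes "\<And>i. i < n \<Longrightarrow> q i < q (Suc i)" "s \<in> {0..1}" "t \<in> {0..1}" "s \<le> t"
  shows "bernstein_sum n q s \<le> bernstein_sum n q t"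
  using assms(1)
proof (induction n arbitrary: q)
  case (Suc n)
  have "bernstein_sum n q s \<le> bernstein_sum n q t"
    "bernstein_sum n (\<lambda>i. q (Suc i)) s \<le> bernstein_sum n (\<lambda>i. q (Suc i)) t"
    using Suc by auto
  moreover have "bernstein_sum n q s < bernstein_sum n (\<lambda>i. q (Suc i)) s"
    using Suc.prems assms(2) by (intro bernstein_sum_strict_mono_coeffs) auto
  ultimately have "0 \<le> bernstein_sum (Suc n) q t - bernstein_sum (Suc n) q s"
    unfolding bernstein_sum_increment using assms(2-4) by (intro add_nonneg_nonneg mult_nonneg_nonneg) auto
  then show ?case
    by simp
qed auto

text \<open>A sum of degree 0 is constant, so strictness starts at degree \<open>Suc n\<close> and
  rests on the weak version one degree lower.\<close>

lemma bernstein_sum_strict_mono: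
  fixes q :: "nat \<Rightarrow> real"
  assumes q: "\<And>i. i < Suc n \<Longrightarrow> q i < q (Suc i)" and st: "s \<in> {0..1}" "t \<in> {0..1}" "s < t"
  shows "bernstein_sum (Suc n) q s < bernstein_sum (Suc n) q t"
proof -
  have "bernstein_sum n q s \<le> bernstein_sum n q t"
    "bernstein_sum n (\<lambda>i. q (Suc i)) s \<le> bernstein_sum n (\<lambda>i. q (Suc i)) t"
    using q st by (auto intro!: bernstein_sum_mono)
  moreover have "bernstein_sum n q s < bernstein_sum n (\<lambda>i. q (Suc i)) s"
    using q st by (intro bernstein_sum_strict_mono_coeffs) auto
  ultimately have "0 < bernstein_sum (Suc n) q t - bernstein_sum (Suc n) q s"
    unfolding bernstein_sum_increment using st by (intro add_pos_nonneg mult_pos_pos mult_nonneg_nonneg) auto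
  then show ?thesis
    by simp
qed

lemma linear_bernstein_sum: "linear f \<Longrightarrow> f (bernstein_sum n q t) = bernstein_sum n (\<lambda>i. f (q i)) t"
  by (simp add: bernstein_sum_def linear_sum linear_scale)

lemma linear_bezier:
  assumes "linear f" "Q \<noteq> []"
  shows "f (bezier Q t) = bezier (map f Q) t"
proof -
  have "f (bezier Q t) = bernstein_sum (length Q - 1) (\<lambda>i. f (Q ! i)) t"
    using assms(1) by (simp add: bezier_eq_bernstein_sum linear_bernstein_sum)
  also have "\<dots> = bernstein_sum (length Q - 1) (\<lambda>i. map f Q ! i) t"
  proof (rule bernstein_sum_cong)
    fix i assume "i \<le> length Q - 1"
    then have "i < length Q"
      using assms(2) by (cases Q) auto
    then show "f (Q ! i) = map f Q ! i"
      by simp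
  qed
  finally show ?thesis
    by (simp add: bezier_eq_bernstein_sum)
qed

lemma path_bezier: "path (bezier Q)"
  unfolding path_def bezier_def Bernstein_def by (intro continuous_intros)

lemma follows_bezier:
  fixes Q :: "'a::euclidean_space list"
  assumes "2 \<le> length Q"
  shows "follows (bezier Q) Q"
  unfolding follows_def
proof (intro conjI allI impI path_bezier)
  have ne: "Q \<noteq> []"
    using assms by auto
  show "pathstart (bezier Q) = hd Q" "pathfinish (bezier Q) = last Q"
    using ne by (auto simp: pathstart_def pathfinish_def bezier_eq_bernstein_sum hd_conv_nth last_conv_nth)
  have "(\<lambda>i. Q ! i) ` {..length Q - 1} = set Q"
    using ne by (cases Q) (auto simp: set_conv_nth less_Suc_eq_le image_def)
  then show "path_image (bezier Q) \<subseteq> convex hull (set Q)"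
    using bernstein_sum_in_convex_hull[of _ "length Q - 1" "\<lambda>i. Q ! i"]
    by (auto simp: path_image_def bezier_eq_bernstein_sum)
  fix f :: "'a \<Rightarrow> real"
  assume f: "linear f" "sorted_wrt (<) (map f Q)"
  obtain n where n: "length Q = Suc (Suc n)"
    using assms by (metis Suc_le_D numeral_2_eq_2 Suc_le_mono)
  have "(f \<circ> bezier Q) t = bernstein_sum (Suc n) (\<lambda>i. map f Q ! i) t" for t
    unfolding o_def linear_bezier[OF f(1) ne] by (simp add: bezier_eq_bernstein_sum n)
  then have less: "(f \<circ> bezier Q) s < (f \<circ> bezier Q) t" if "s \<in> {0..1}" "t \<in> {0..1}" "s < t" for s t
    using bernstein_sum_strict_mono[of n "\<lambda>i. map f Q ! i" s t] that f n
    by (simp add: sorted_wrt_iff_nth_less del: o_apply)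
  show "inj_on (f \<circ> bezier Q) {0..1}"
    by (rule linorder_inj_onI) (use less in \<open>fastforce+\<close>)
qed

section \<open>Subdivision as halving of the parameter interval\<close>

lemma de_casteljau_eq: "de_casteljau Q r k = bernstein_sum r (\<lambda>i. Q ! (k + i)) (1/2)"
  by (induction r arbitrary: k) (simp_all add: bernstein_sum_Suc midpoint_def scaleR_right_distrib)

text \<open>Raising \<open>r\<close> by one averages the inner sums of \<open>q\<close> and of its
  shift, so the induction hypothesis applies to both. The weights agree because
  \<open>(1 - t) + t/2 = 1 - t/2\<close>.\<close>

lemma bernstein_sum_left_half:
  "bernstein_sum n (\<lambda>r. bernstein_sum r q (1/2)) t = bernstein_sum n q (t/2)"
proof (induction n arbitrary: q)
  case (Suc n)
  have add: "bernstein_sum n (\<lambda>r. (1/2) *\<^sub>R f r + (1/2) *\<^sub>R g r) t =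
      (1/2) *\<^sub>R bernstein_sum n f t + (1/2) *\<^sub>R bernstein_sum n g t" for f g :: "nat \<Rightarrow> 'a"
    by (simp add: bernstein_sum_def scaleR_right_distrib sum.distrib scaleR_sum_right mult_ac)
  have "bernstein_sum (Suc n) (\<lambda>r. bernstein_sum r q (1/2)) t =
      (1 - t) *\<^sub>R bernstein_sum n q (t/2) +
      t *\<^sub>R ((1/2) *\<^sub>R bernstein_sum n q (t/2) + (1/2) *\<^sub>R bernstein_sum n (\<lambda>i. q (Suc i)) (t/2))"
    by (simp add: bernstein_sum_Suc[of n] bernstein_sum_Suc[of _ q] add flip: Suc)
  also have "\<dots> = bernstein_sum (Suc n) q (t/2)"
    by (simp add: bernstein_sum_Suc[of n] scaleR_right_distrib algebra_simps flip: scaleR_left_distrib)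
  finally show ?case .
qed auto

lemma bernstein_sum_right_half:
  "bernstein_sum n (\<lambda>k. bernstein_sum (n - k) (\<lambda>i. q (k + i)) (1/2)) t = bernstein_sum n q ((1 + t)/2)"
proof (induction n arbitrary: q)
  case (Suc n)
  have add: "bernstein_sum n (\<lambda>r. (1/2) *\<^sub>R f r + (1/2) *\<^sub>R g r) t =
      (1/2) *\<^sub>R bernstein_sum n f t + (1/2) *\<^sub>R bernstein_sum n g t" for f g :: "nat \<Rightarrow> 'a"
    by (simp add: bernstein_sum_def scaleR_right_distrib sum.distrib scaleR_sum_right mult_ac)
  let ?u = "(1 + t)/2"
  have "bernstein_sum n (\<lambda>k. bernstein_sum (Suc n - k) (\<lambda>i. q (k + i)) (1/2)) t =
      bernstein_sum n (\<lambda>k. (1/2) *\<^sub>R bernstein_sum (n - k) (\<lambda>i. q (k + i)) (1/2) +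
        (1/2) *\<^sub>R bernstein_sum (n - k) (\<lambda>i. q (Suc (k + i))) (1/2)) t"
    by (rule bernstein_sum_cong) (simp add: Suc_diff_le bernstein_sum_Suc)
  also have "\<dots> = (1/2) *\<^sub>R bernstein_sum n q ?u + (1/2) *\<^sub>R bernstein_sum n (\<lambda>i. q (Suc i)) ?u"
    using Suc[of q] Suc[of "\<lambda>i. q (Suc i)"] by (simp add: add)
  finally have "bernstein_sum (Suc n) (\<lambda>k. bernstein_sum (Suc n - k) (\<lambda>i. q (k + i)) (1/2)) t =
      (1 - t) *\<^sub>R ((1/2) *\<^sub>R bernstein_sum n q ?u + (1/2) *\<^sub>R bernstein_sum n (\<lambda>i. q (Suc i)) ?u) +
      t *\<^sub>R bernstein_sum n (\<lambda>i. q (Suc i)) ?u"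
    using Suc[of "\<lambda>i. q (Suc i)"] by (simp add: bernstein_sum_Suc[of n])
  \<comment> \<open>The two weights are \<open>1 - ?u\<close> and \<open>?u\<close>.\<close>
  also have "\<dots> = ((1 - t)/2) *\<^sub>R bernstein_sum n q ?u + ((1 - t)/2 + t) *\<^sub>R bernstein_sum n (\<lambda>i. q (Suc i)) ?u"
    by (simp add: scaleR_right_distrib scaleR_left_distrib)
  also have "\<dots> = bernstein_sum (Suc n) q ?u"
    unfolding bernstein_sum_Suc[of n] by (intro arg_cong2[of _ _ _ _ "(+)"] arg_cong2[of _ _ _ _ scaleR]) (auto simp: field_simps)
  finally show ?case .
qed auto

lemma length_subdivide [simp]: "length (subdivide_left Q) = length Q" "length (subdivide_right Q) = length Q"
  by (simp_all add: subdivide_left_def subdivide_right_def)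

lemma bezier_subdivide_left: "Q \<noteq> [] \<Longrightarrow> bezier (subdivide_left Q) t = bezier Q (t/2)"
proof -
  assume "Q \<noteq> []"
  then have "bezier (subdivide_left Q) t = bernstein_sum (length Q - 1) (\<lambda>r. bernstein_sum r (\<lambda>i. Q ! i) (1/2)) t"
    unfolding bezier_eq_bernstein_sum length_subdivide
    by (intro bernstein_sum_cong) (cases Q; simp add: subdivide_left_def de_casteljau_eq del: upt_Suc)
  then show ?thesis
    by (simp add: bernstein_sum_left_half bezier_eq_bernstein_sum)
qed

lemma bezier_subdivide_right: "Q \<noteq> [] \<Longrightarrow> bezier (subdivide_right Q) t = bezier Q ((1 + t)/2)"
proof -
  assume "Q \<noteq> []"
  then have "bezier (subdivide_right Q) t = bernstein_sum (length Q - 1)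
      (\<lambda>k. bernstein_sum (length Q - 1 - k) (\<lambda>i. Q ! (k + i)) (1/2)) t"
    unfolding bezier_eq_bernstein_sum length_subdivide
    by (intro bernstein_sum_cong) (cases Q; simp add: subdivide_right_def de_casteljau_eq del: upt_Suc)
  then show ?thesis
    by (simp only: bernstein_sum_right_half bezier_eq_bernstein_sum)
qed

lemma bezier_curve_subdivide:
  assumes "Q \<noteq> []"
  shows "bezier_curve Q = bezier_curve (subdivide_left Q) \<union> bezier_curve (subdivide_right Q)"
proof -
  have "{0..1::real} = (\<lambda>t. t/2) ` {0..1} \<union> (\<lambda>t. (1 + t)/2) ` {0..1}"
  proof (intro equalityI subsetI)
    fix t :: real assume "t \<in> {0..1}"
    then have "t = (2 * t)/2 \<and> 2 * t \<in> {0..1} \<or> t = (1 + (2 * t - 1))/2 \<and> 2 * t - 1 \<in> {0..1}"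
      by auto
    then show "t \<in> (\<lambda>t. t/2) ` {0..1} \<union> (\<lambda>t. (1 + t)/2) ` {0..1}"
      by blast
  qed auto
  then have "bezier Q ` {0..1} = (\<lambda>t. bezier Q (t/2)) ` {0..1} \<union> (\<lambda>t. bezier Q ((1 + t)/2)) ` {0..1}"
    by (metis image_Un image_image)
  then show ?thesis
    using assms by (simp add: bezier_curve_def path_image_def bezier_subdivide_left bezier_subdivide_right)
qed

lemma subdivide_Cons [simp]: "subdivide (Q # Qs) = subdivide_left Q # subdivide_right Q # subdivide Qs"
  and subdivide_Nil [simp]: "subdivide [] = []"
  by (simp_all add: subdivide_def)

lemma set_subdivide: "set (subdivide Qs) = subdivide_left ` set Qs \<union> subdivide_right ` set Qs"
  by (induction Qs) auto

lemma length_iterated_subdivide: "length ((subdivide ^^ m) Qs) = 2 ^ m * length Qs"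
proof -
  have "length (subdivide Qs) = 2 * length Qs" for Qs :: "'a list list"
    by (induction Qs) auto
  then show ?thesis
    by (induction m) auto
qed

lemma length_in_iterated_subdivide:
  assumes "\<forall>Q \<in> set Qs. length Q = n"
  shows "\<forall>Q \<in> set ((subdivide ^^ m) Qs). length Q = n"
  by (induction m) (use assms in \<open>auto simp: set_subdivide\<close>)

lemma bezier_curve_iterated_subdivide:
  assumes "[] \<notin> set Qs"
  shows "(\<Union>Q \<in> set ((subdivide ^^ m) Qs). bezier_curve Q) = (\<Union>Q \<in> set Qs. bezier_curve Q)"
proof -
  have "[] \<notin> set ((subdivide ^^ m) Qs) \<and>
      (\<Union>Q \<in> set ((subdivide ^^ m) Qs). bezier_curve Q) = (\<Union>Q \<in> set Qs. bezier_curve Q)"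
  proof (induction m)
    case (Suc m)
    let ?Qs = "(subdivide ^^ m) Qs"
    have "[] \<noteq> subdivide_left Q" "[] \<noteq> subdivide_right Q" if "Q \<in> set ?Qs" for Q
      using Suc that by (metis length_0_conv length_subdivide)+
    then have "[] \<notin> set (subdivide ?Qs)"
      by (auto simp: set_subdivide)
    moreover have "(\<Union>Q \<in> set (subdivide ?Qs). bezier_curve Q) = (\<Union>Q \<in> set ?Qs. bezier_curve Q)"
    proof -
      have "(\<Union>Q \<in> set (subdivide ?Qs). bezier_curve Q) =
          (\<Union>Q \<in> set ?Qs. bezier_curve (subdivide_left Q) \<union> bezier_curve (subdivide_right Q))"
        by (auto simp: set_subdivide)
      also have "\<dots> = (\<Union>Q \<in> set ?Qs. bezier_curve Q)"
        by (intro SUP_cong refl) (metis Suc bezier_curve_subdivide)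
      finally show ?thesis .
    qed
    ultimately show ?case
      using Suc by simp
  qed (use assms in simp)
  then show ?thesis ..
qed

section \<open>Polygonal paths\<close>

text \<open>The recursion ends with a segment and not with a point: a constant last piece would
  destroy injectivity.\<close>

fun pl_path :: "'a::real_normed_vector list \<Rightarrow> real \<Rightarrow> 'a" where
  "pl_path [a, b] = linepath a b"
| "pl_path (a # b # c # Q) = linepath a b +++ pl_path (b # c # Q)"

lemma pl_curve_Cons: "pl_curve (a # b # Q) = closed_segment a b \<union> pl_curve (b # Q)"
proof -
  have "{i. Suc i < length (a # b # Q)} = insert 0 (Suc ` {i. Suc i < length (b # Q)})"
    by (auto simp: image_iff less_Suc_eq_0_disj)
  then show ?thesis
    by (auto simp: pl_curve_def)
qed

lemma pl_curve_singleton: "pl_curve [a] = {}"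
  by (simp add: pl_curve_def)

lemma pl_path_ends:
  assumes "2 \<le> length Q"
  shows "pathstart (pl_path Q) = hd Q" "pathfinish (pl_path Q) = last Q" "path (pl_path Q)"
proof -
  have "2 \<le> length Q \<longrightarrow> pathstart (pl_path Q) = hd Q \<and> pathfinish (pl_path Q) = last Q \<and> path (pl_path Q)"
    by (induction Q rule: pl_path.induct) auto
  then show "pathstart (pl_path Q) = hd Q" "pathfinish (pl_path Q) = last Q" "path (pl_path Q)"
    using assms by auto
qed

lemma path_image_pl_path:
  "2 \<le> length Q \<Longrightarrow> path_image (pl_path Q) = pl_curve Q"
  by (induction Q rule: pl_path.induct)
    (auto simp: path_image_join pl_path_ends pl_curve_Cons pl_curve_singleton)

lemma pl_curve_subset_convex_hull: "pl_curve Q \<subseteq> convex hull (set Q)"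
proof -
  have "closed_segment (Q ! i) (Q ! Suc i) \<subseteq> convex hull (set Q)" if "Suc i < length Q" for i
    using that by (intro closed_segment_subset_convex_hull hull_inc) auto
  then show ?thesis
    by (auto simp: pl_curve_def)
qed

lemma linear_pl_path:
  assumes "linear f" "2 \<le> length Q"
  shows "f \<circ> pl_path Q = pl_path (map f Q)"
  using assms(2)
proof (induction Q rule: pl_path.induct)
  case (1 a b)
  then show ?case
    using assms(1) by (auto simp: linepath_def linear_add linear_scale)
next
  case (2 a b c Q)
  have "f \<circ> linepath a b = linepath (f a) (f b)"
    using assms(1) by (auto simp: linepath_def linear_add linear_scale)
  moreover have "f \<circ> pl_path (b # c # Q) = pl_path (f b # f c # map f Q)"
    by (rule "2.IH"[unfolded list.map]) simp
  ultimately show ?case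
    by (simp only: path_compose_join pl_path.simps list.map)
qed auto

text \<open>The first segment stays below its right end \<open>b\<close>, and the rest of the path
  stays above it.\<close>

lemma arc_pl_path_real:
  fixes Q :: "real list"
  shows "2 \<le> length Q \<Longrightarrow> sorted_wrt (<) Q \<Longrightarrow> arc (pl_path Q)"
proof (induction Q rule: pl_path.induct)
  case (2 a b c Q)
  have "pl_curve (b # c # Q) \<subseteq> convex hull (set (b # c # Q))"
    by (rule pl_curve_subset_convex_hull)
  also have "\<dots> \<subseteq> {b..}"
    using 2 by (intro hull_minimal) auto
  finally have "path_image (linepath a b) \<inter> path_image (pl_path (b # c # Q)) \<subseteq> {b}"
    using 2 by (auto simp: path_image_pl_path closed_segment_eq_real_ivl)
  then show ?case
    using 2 by (auto intro!: arc_join simp: pl_path_ends)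
qed auto

lemma follows_pl_path:
  fixes Q :: "'a::euclidean_space list"
  assumes "2 \<le> length Q"
  shows "follows (pl_path Q) Q"
  unfolding follows_def
proof (intro conjI allI impI)
  show "path_image (pl_path Q) \<subseteq> convex hull (set Q)"
    using assms pl_curve_subset_convex_hull by (simp add: path_image_pl_path)
  show "inj_on (f \<circ> pl_path Q) {0..1}" if "linear f" "sorted_wrt (<) (map f Q)" for f :: "'a \<Rightarrow> real"
    using arc_pl_path_real[OF _ that(2)] assms that(1) by (simp add: linear_pl_path arc_def)
qed (use assms in \<open>simp_all add: pl_path_ends\<close>)

text \<open>\<open>path_of\<close> stands for \<open>bezier\<close> or \<open>pl_path\<close>; only
  \<open>follows\<close> is known about it, so curve and polygon share the argument.\<close>

lemma chain_mutually_isotopic_standard_circle: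
  fixes Ps :: "(real^3) list list" and a b c1 c2 c3 :: real
    and path_of :: "(real^3) list \<Rightarrow> real \<Rightarrow> real^3"
  defines "L \<equiv> \<lambda>p::real^3. (a * p $ 2 + b * p $ 3, c1 * p $ 1 + c2 * p $ 2 + c3 * p $ 3)"
  assumes "b \<noteq> 0" "c1 \<noteq> 0" "snd w \<noteq> 0"
    and follows: "\<And>Q. 2 \<le> length Q \<Longrightarrow> follows (path_of Q) Q"
    and length: "\<forall>Q \<in> set (R1 # R2 # Ps). 2 \<le> length Q" and "Ps \<noteq> []"
    and proj: "map (map L) Ps = map (map real_pt) As" "map L R1 = map real_pt B1" "map L R2 = map real_pt B2"
    and cert: "arc_certificate D As" "arc_certificate D [B1, B2]" "cap_certificate w As B1 B2"
    and closed: "successively (\<lambda>P Q. last P = hd Q) (Ps @ [R1, R2])" "last R2 = hd (hd Ps)"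
  shows "mutually_isotopic (\<Union>Q \<in> set (R1 # R2 # Ps). path_image (path_of Q)) standard_circle"
proof -
  have L: "linear L"
    unfolding L_def by (rule linearI) (simp_all add: algebra_simps)
  have LQ: "follows (L \<circ> path_of Q) (map L Q)" if "2 \<le> length Q" for Q
    using that by (intro follows_linear_image[OF follows L]) auto
  have ends: "pathstart (path_of Q) = hd Q" "pathfinish (path_of Q) = last Q" "path (path_of Q)"
    if "Q \<in> set (R1 # R2 # Ps)" for Q
    using follows length that unfolding follows_def by blast+
  have lens: "length Ps = length As" and nth: "\<And>i. i < length As \<Longrightarrow> map L (Ps ! i) = map real_pt (As ! i)"
    using proj(1) by (metis length_map, metis length_map nth_map)
  have "mutually_isotopic (\<Union>p \<in> set (path_of R1 # path_of R2 # map path_of Ps). path_image p) standard_circle"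
  proof (rule closed_chain_mutually_isotopic_standard_circle
      [where a = a and b = b and ?c1.0 = c1 and ?c2.0 = c2 and ?c3.0 = c3 and w = w and D = D and As = As
        and ?B1.0 = B1 and ?B2.0 = B2, folded L_def])
    show "list_all2 (\<lambda>p Q. follows (L \<circ> p) (map real_pt Q)) (map path_of Ps) As"
      unfolding list_all2_conv_all_nth
    proof (intro conjI allI impI)
      fix i assume "i < length (map path_of Ps)"
      then show "follows (L \<circ> map path_of Ps ! i) (map real_pt (As ! i))"
        using LQ[of "Ps ! i"] length nth[of i] lens by simp
    qed (use lens in simp)
    show "[] \<notin> set As"
    proof
      assume "[] \<in> set As"
      then have "[] \<in> set (map (map L) Ps)"
        unfolding proj(1) by force
      then show False
        using length by auto
    qed
    show "As \<noteq> []"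
      using lens \<open>Ps \<noteq> []\<close> by auto
    show "follows (L \<circ> path_of R1) (map real_pt B1)" "follows (L \<circ> path_of R2) (map real_pt B2)"
      using LQ[of R1] LQ[of R2] length proj(2,3) by simp_all
    show "B1 \<noteq> []" "B2 \<noteq> []"
      using proj(2,3) length by auto
    have "consecutive (map path_of (Ps @ [R1, R2]))"
      unfolding successively_map
      by (rule successively_mono[OF closed(1)]) (use ends in auto)
    then show "consecutive (map path_of Ps @ [path_of R1, path_of R2])"
      by simp
    show "pathfinish (path_of R2) = pathstart (hd (map path_of Ps))"
      using closed(2) ends \<open>Ps \<noteq> []\<close> by (simp add: hd_map)
  qed (use assms ends in auto)
  then show ?thesis
    by simp
qed

section \<open>Computing subdivisions\<close>

fun midpoints :: "'a::real_vector list \<Rightarrow> 'a list" where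
  "midpoints (a # b # Q) = midpoint a b # midpoints (b # Q)"
| "midpoints Q = []"

lemma length_midpoints [simp]: "length (midpoints Q) = length Q - 1"
  by (induction Q rule: midpoints.induct) auto

lemma nth_midpoints: "Suc i < length Q \<Longrightarrow> midpoints Q ! i = midpoint (Q ! i) (Q ! Suc i)"
  by (induction Q arbitrary: i rule: midpoints.induct) (auto simp: nth_Cons split: nat.splits)

text \<open>The definition peels off the last level. Peeling off the first one instead turns
  subdivision into a recursion through successive rows of midpoints, which rewriting can carry out
  without recomputing points.\<close>

lemma de_casteljau_Suc_eq:
  "Suc (r + k) < length Q \<Longrightarrow> de_casteljau Q (Suc r) k = de_casteljau (midpoints Q) r k"
proof (induction r arbitrary: k)
  case (Suc r)
  have "de_casteljau Q (Suc (Suc r)) k = midpoint (de_casteljau Q (Suc r) k) (de_casteljau Q (Suc r) (Suc k))"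
    by simp
  also have "\<dots> = de_casteljau (midpoints Q) (Suc r) k"
    using Suc by (simp del: de_casteljau.simps(2) add: de_casteljau.simps(2)[of "midpoints Q"])
  finally show ?case .
qed (simp add: nth_midpoints)

lemma subdivide_left_rec:
  "subdivide_left [a] = [a]"
  "subdivide_left (a # b # Q) = a # subdivide_left (midpoints (a # b # Q))"
proof -
  show "subdivide_left [a] = [a]"
    by (simp add: subdivide_left_def)
  let ?Q = "a # b # Q"
  have "subdivide_left ?Q = map (\<lambda>r. de_casteljau ?Q r 0) (0 # map Suc [0..<length (midpoints ?Q)])"
    by (simp add: subdivide_left_def map_Suc_upt upt_conv_Cons del: upt_Suc)
  also have "\<dots> = a # subdivide_left (midpoints ?Q)"
    by (simp add: subdivide_left_def de_casteljau_Suc_eq del: de_casteljau.simps(2) midpoints.simps)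
  finally show "subdivide_left ?Q = a # subdivide_left (midpoints ?Q)" .
qed

lemma subdivide_right_rec:
  "subdivide_right [a] = [a]"
  "subdivide_right (a # b # Q) = subdivide_right (midpoints (a # b # Q)) @ [last (b # Q)]"
proof -
  show "subdivide_right [a] = [a]"
    by (simp add: subdivide_right_def)
  let ?Q = "a # b # Q"
  have "de_casteljau ?Q (length ?Q - 1 - k) k = de_casteljau (midpoints ?Q) (length (midpoints ?Q) - 1 - k) k"
    if "k < length (midpoints ?Q)" for k
  proof -
    have "length ?Q - 1 - k = Suc (length (midpoints ?Q) - 1 - k)"
      using that by simp
    then show ?thesis
      using that by (simp only:) (subst de_casteljau_Suc_eq, auto)
  qed
  then have "map (\<lambda>k. de_casteljau ?Q (length ?Q - 1 - k) k) [0..<length (midpoints ?Q)] = subdivide_right (midpoints ?Q)"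
    unfolding subdivide_right_def by (intro map_cong) auto
  moreover have "[0..<length ?Q] = [0..<length (midpoints ?Q)] @ [length ?Q - 1]"
    by simp
  ultimately show "subdivide_right ?Q = subdivide_right (midpoints ?Q) @ [last (b # Q)]"
    unfolding subdivide_right_def[of ?Q] map_append by (simp add: last_conv_nth del: upt_Suc midpoints.simps)
qed

lemma linear_midpoint: "linear f \<Longrightarrow> f (midpoint x y) = midpoint (f x) (f y)"
  by (simp add: midpoint_def linear_add linear_scale)

text \<open>The bound keeps every index that is read inside the list, where \<open>map\<close>
  commutes with \<open>!\<close>.\<close>

lemma linear_de_casteljau:
  "linear f \<Longrightarrow> r + k < length Q \<Longrightarrow> f (de_casteljau Q r k) = de_casteljau (map f Q) r k"
  by (induction r arbitrary: k) (simp_all add: linear_midpoint)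

lemma map_subdivide_left: "linear f \<Longrightarrow> map f (subdivide_left Q) = subdivide_left (map f Q)"
  by (simp add: subdivide_left_def linear_de_casteljau)

lemma map_subdivide_right: "linear f \<Longrightarrow> map f (subdivide_right Q) = subdivide_right (map f Q)"
  by (simp add: subdivide_right_def linear_de_casteljau)

lemma map_subdivide: "linear f \<Longrightarrow> map (map f) (subdivide Qs) = subdivide (map (map f) Qs)"
  by (induction Qs) (simp_all add: map_subdivide_left map_subdivide_right)

text \<open>Subdivision can thus be computed on the projected control points instead of in
  space.\<close>

lemma map_iterated_subdivide:
  "linear f \<Longrightarrow> map (map f) ((subdivide ^^ m) Qs) = (subdivide ^^ m) (map (map f) Qs)"
  by (induction m) (simp_all add: map_subdivide)

lemma subdivide_ends:
  assumes "Q \<noteq> []"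
  shows "hd (subdivide_left Q) = hd Q" "last (subdivide_left Q) = hd (subdivide_right Q)"
    "last (subdivide_right Q) = last Q"
  using assms by (simp_all add: subdivide_left_def subdivide_right_def hd_map last_map hd_conv_nth last_conv_nth)

lemma successively_subdivide:
  assumes "[] \<notin> set Qs" "successively (\<lambda>P Q. last P = hd Q) Qs"
  shows "successively (\<lambda>P Q. last P = hd Q) (subdivide Qs)"
  using assms by (induction Qs rule: induct_list012) (auto simp: subdivide_ends)

lemma ends_subdivide:
  assumes "[] \<notin> set Qs" "Qs \<noteq> []"
  shows "hd (hd (subdivide Qs)) = hd (hd Qs)" "last (last (subdivide Qs)) = last (last Qs)" "[] \<notin> set (subdivide Qs)"
proof -
  show "hd (hd (subdivide Qs)) = hd (hd Qs)"
    using assms by (cases Qs) (auto simp: subdivide_ends)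
  show "last (last (subdivide Qs)) = last (last Qs)"
    using assms by (cases Qs rule: rev_cases) (auto simp: subdivide_def subdivide_ends)
  have "[] \<noteq> subdivide_left Q" "[] \<noteq> subdivide_right Q" if "Q \<in> set Qs" for Q
    using assms that by (metis length_0_conv length_subdivide)+
  then show "[] \<notin> set (subdivide Qs)"
    by (auto simp: set_subdivide)
qed

lemma iterated_subdivide_chain:
  fixes P :: "'a::real_normed_vector list" and m :: nat
  assumes "P \<noteq> []"
  defines "Qs \<equiv> (subdivide ^^ m) [P]"
  shows "successively (\<lambda>P Q. last P = hd Q) Qs" "hd (hd Qs) = hd P" "last (last Qs) = last P"
proof -
  have "successively (\<lambda>P Q. last P = hd Q) Qs \<and> hd (hd Qs) = hd P \<and> last (last Qs) = last P \<and>
      [] \<notin> set Qs \<and> Qs \<noteq> []"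
    unfolding Qs_def
  proof (induction m)
    case (Suc m)
    let ?Qs = "(subdivide ^^ m) [P]"
    have "subdivide ?Qs \<noteq> []"
      using Suc by (cases ?Qs) auto
    then show ?case
      using Suc successively_subdivide[of ?Qs] ends_subdivide[of ?Qs] by simp
  qed (use assms in auto)
  then show "successively (\<lambda>P Q. last P = hd Q) Qs" "hd (hd Qs) = hd P" "last (last Qs) = last P"
    by auto
qed

section \<open>The curve of degree six\<close>

text \<open>The images under \<open>proj\<close>, defined below, of the sixteen lists of the fourth subdivision.\<close>

definition curve_points :: "(int \<times> int) list list" where
  "curve_points = [
    [(670014898176, 1202590842880), (445602856960, 923417968640), (249980518400, 672430817280),
     (80329310208, 448132022272), (-65914798080, 248994856960), (-191087001600, 73479454720),
     (-297316184064, -79952875520)],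
    [(-297316184064, -79952875520), (-403545366528, -233385205760), (-490831527936, -364734464000),
     (-561303552000, -475539341312), (-616884011008, -567337353216), (-659311689728, -641650524160),
     (-690160926720, -699972976640)],
    [(-690160926720, -699972976640), (-721010163712, -758295429120), (-740280958976, -800627163136),
     (-749547651072, -828462301184), (-750220132352, -843267063808), (-743563190272, -846467358720),
     (-730712666112, -839438274560)],
    [(-730712666112, -839438274560), (-717862141952, -832409190400), (-698818035712, -815150727168),
     (-674716188672, -789037973504), (-646563495936, -755395198976), (-615254065152, -715485347840),
     (-581582192640, -670501437440)],
    [(-581582192640, -670501437440), (-547910320128, -625517527040), (-511876005888, -575459557376),
     (-474273546240, -521520545792), (-435797426176, -464823582720), (-397055295488, -406413230080),
     (-358577762304, -347248824320)],
    [(-358577762304, -347248824320), (-320100229120, -288084418560), (-281887293440, -228165959680),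
     (-244469563392, -168452784128), (-208300605440, -109819002880), (-173766737920, -53046804480),
     (-141193641984, 1178337280)],
    [(-141193641984, 1178337280), (-108620546048, 55403479040), (-78008221696, 107081564160),
     (-49682350080, 155527118848), (-23907975168, 200151384064), (-896114688, 240467107840),
     (19192811520, 276091432960)],
    [(19192811520, 276091432960), (39281737728, 311715758080), (56447729664, 342648684544),
     (70530367488, 368507355136), (81419829248, 389013307392), (89053462528, 403995361280),
     (93415538688, 413390602240)],
    [(93415538688, 413390602240), (97777614848, 422785843200), (98868133888, 426594271232),
     (96671367168, 424752971776), (91218509824, 417307295744), (82587435008, 404411842560),
     (70905630720, 386329538560)],
    [(70905630720, 386329538560), (59223826432, 368247234560), (44491292672, 344978079744),
     (26835517440, 316785000448), (6433603584, 284039249920), (-16484794368, 247219486720),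
     (-41631350784, 206908948480)],
    [(-41631350784, 206908948480), (-66777907200, 166598410240), (-94152622080, 122797096960),
     (-123467169792, 76088246272), (-154374553600, 27159674880), (-186462986240, -23199047680),
     (-219246587904, -74101329920)],
    [(-219246587904, -74101329920), (-252030189568, -125003612160), (-285508960256, -176449454080),
     (-319197020160, -227552264192), (-352534396928, -277328429056), (-384877723648, -324702044160),
     (-415487754240, -368511549440)],
    [(-415487754240, -368511549440), (-446097784832, -412321054720), (-474974519296, -452566450176),
     (-501378711552, -488086175744), (-524475236352, -517633015808), (-543320604672, -539880734720),
     (-556847296512, -553432616960)],
    [(-556847296512, -553432616960), (-570373988352, -566984499200), (-578582003712, -571840544768),
     (-580403822592, -566604038144), (-574647894016, -549807783936), (-559982968832, -519922647040),
     (-534919249920, -475367997440)],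
    [(-534919249920, -475367997440), (-509855531008, -430813347840), (-474393018368, -371589185536),
     (-427041914880, -296114880512), (-366153875456, -202758307840), (-289903157248, -89846292480),
     (-196264587264, 44323041280)],
    [(-196264587264, 44323041280), (-102626017280, 178492375040), (8400404480, 333919027200),
     (138839851008, 512304873472), (290916925440, 715380490240), (467077693440, 944892805120),
     (670014898176, 1202590842880)]]"

text \<open>The Bezier curve leaves and enters its corner in almost the same projected direction, so the hulls
  of the first and the last piece overlap. They are separated after subdividing the last piece once more
  and the first piece twice towards the corner.\<close>

definition refined_points_0 :: "(int \<times> int) list list" where
  "refined_points_0 = [
    [(670014898176, 1202590842880), (613911887872, 1132797624320), (559608233984, 1064766013440),
     (507059896320, 998472613888), (456223828992, 933893914624), (407057955312, 871006305760),
     (359521143465, 809786093935)],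
    [(359521143465, 809786093935), (311984331618, 748565882110), (266076581604, 689013067324),
     (221756761608, 631103956216), (178984684688, 574814771952), (137721084448, 520121669600),
     (97927591488, 467000751040)],
    [(97927591488, 467000751040), (18340605568, 360758913920), (-55365951232, 260805811968),
     (-123499034112, 166950260224), (-186351246336, 79000222720), (-244201592832, -3236710400),
     (-297316184064, -79952875520)]]"

definition refined_points_15 :: "(int \<times> int) list list" where
  "refined_points_15 = [
    [(-196264587264, 44323041280), (-149445302272, 111407708160), (-98279054336, 183806704640),
     (-42512696832, 261732765184), (18119381248, 345400418048), (83895943808, 435025599360),
     (155109645888, 530825237440)],
    [(155109645888, 530825237440), (226323347968, 626624875520), (302974189568, 728598970368),
     (385354825728, 836964450304), (473771802624, 951939235840), (568546295808, 1073741824000),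
     (670014898176, 1202590842880)]]"

text \<open>A projection with kernel spanned by \<open>(-7, -3, 2)\<close>, a direction in which the curve has no double
  points; the factor \<open>2 ^ 33\<close> makes all subdivision points integral. Its shape fits the
  functionals \<open>V\<close> and \<open>c1 x + c2 y + c3 z\<close> of the general lemmas.\<close>

definition proj :: "real^3 \<Rightarrow> real \<times> real" where
  "proj = (\<lambda>p. (2 ^ 34 * p $ 2 + 3 * 2 ^ 33 * p $ 3, 2 ^ 34 * p $ 1 + 0 * p $ 2 + 7 * 2 ^ 33 * p $ 3))"

lemma linear_proj: "linear proj"
  unfolding proj_def by (rule linearI) (simp_all add: algebra_simps)

lemma funpow_4: "(f ^^ 4) x = f (f (f (f x)))"
  by (simp add: eval_nat_numeral)

lemma midpoint_Pair: "midpoint (a, b) (c, d) = ((a + c) / 2, (b + d) / 2)" for a b c d :: real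
  by (simp add: midpoint_def)

lemma proj_subdivision: "map (map proj) ((subdivide ^^ 4) [control_points]) = map (map real_pt) curve_points"
proof -
  have "map proj control_points = [(670014898176, 1202590842880), (-2920577761280, -3264175144960), (858993459200, -515396075520), (463856467968, 3315714752512), (1030792151040, 171798691840), (-2576980377600, -2920577761280), (670014898176, 1202590842880)]"
    by (simp add: proj_def control_points_def)
  then have "map (map proj) ((subdivide ^^ 4) [control_points]) = (subdivide ^^ 4) [[(670014898176, 1202590842880), (-2920577761280, -3264175144960), (858993459200, -515396075520), (463856467968, 3315714752512), (1030792151040, 171798691840), (-2576980377600, -2920577761280), (670014898176, 1202590842880)]]"
    by (simp add: map_iterated_subdivide[OF linear_proj])
  also have "\<dots> = map (map real_pt) curve_points"
    by (simp add: funpow_4 subdivide_left_rec subdivide_right_rec midpoint_Pair curve_points_def real_pt_def)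
  finally show ?thesis .
qed

text \<open>The first five directions suffice for all pairs of pieces outside the cap, the last one for the cap.\<close>

abbreviation directions :: "(int \<times> int) list" where
  "directions \<equiv> [(1, -1), (-7, 5), (-13, 8), (-13, 10), (-19, 15), (1, 1)]"

lemma arc_certificate_cap: "arc_certificate directions [curve_points ! 3, curve_points ! 4]"
  by code_simp

text \<open>\<open>S\<close> and \<open>T\<close> replace the first and the last piece, in different
  ways for curve and polygon. The cap consists of pieces 3 and 4, counted from 0;
  \<open>(-2503405, 1892776)\<close> is the primitive integer normal of the line through its outer
  end points, signed so that the cap is on the lower side.\<close>

lemma refined_subdivision_mutually_isotopic_standard_circle:
  fixes path_of :: "(real^3) list \<Rightarrow> real \<Rightarrow> real^3"
  defines "Qs \<equiv> (subdivide ^^ 4) [control_points]"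
  assumes follows: "\<And>Q. 2 \<le> length Q \<Longrightarrow> follows (path_of Q) Q"
    and length: "\<forall>Q \<in> set (S @ T). 2 \<le> length Q"
    and S: "S \<noteq> []" "successively (\<lambda>P Q. last P = hd Q) S" "hd (hd S) = hd (hd Qs)" "last (last S) = last (hd Qs)"
      "(\<Union>Q \<in> set S. path_image (path_of Q)) = path_image (path_of (hd Qs))"
      "map (map proj) S = map (map real_pt) S'"
    and T: "T \<noteq> []" "successively (\<lambda>P Q. last P = hd Q) T" "hd (hd T) = hd (last Qs)" "last (last T) = last (last Qs)"
      "(\<Union>Q \<in> set T. path_image (path_of Q)) = path_image (path_of (last Qs))"
      "map (map proj) T = map (map real_pt) T'"
    and cert: "arc_certificate directions (drop 5 (butlast curve_points) @ T' @ S' @ take 2 (tl curve_points))"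
      "cap_certificate (-2503405, 1892776) (drop 5 (butlast curve_points) @ T' @ S' @ take 2 (tl curve_points))
        (curve_points ! 3) (curve_points ! 4)"
  shows "mutually_isotopic (\<Union>Q \<in> set Qs. path_image (path_of Q)) standard_circle"
proof -
  have "length Qs = 16"
    by (simp add: Qs_def length_iterated_subdivide)
  then obtain q0 q1 q2 q3 q4 q5 q6 q7 q8 q9 q10 q11 q12 q13 q14 q15 where
    Qs: "Qs = [q0, q1, q2, q3, q4, q5, q6, q7, q8, q9, q10, q11, q12, q13, q14, q15]"
    by (auto simp: numeral_eq_Suc length_Suc_conv)
  have len7: "\<forall>Q \<in> set Qs. length Q = 7"
    unfolding Qs_def by (rule length_in_iterated_subdivide) (simp add: control_points_def)
  have chain: "successively (\<lambda>P Q. last P = hd Q) Qs" "last q15 = hd q0"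
    using iterated_subdivide_chain[of control_points 4] unfolding Qs_def[symmetric]
    by (simp_all add: Qs control_points_def)
  have proj: "map (map proj) Qs = map (map real_pt) curve_points"
    unfolding Qs_def by (rule proj_subdivision)
  \<comment> \<open>The cyclic order starts just after the cap, so that the corner between the last
    and the first piece becomes an ordinary joint of the chain.\<close>
  let ?Ps = "[q5, q6, q7, q8, q9, q10, q11, q12, q13, q14] @ T @ S @ [q1, q2]"
  have "mutually_isotopic (\<Union>Q \<in> set (q3 # q4 # ?Ps). path_image (path_of Q)) standard_circle"
  proof (rule chain_mutually_isotopic_standard_circle
      [where a = "2 ^ 34" and b = "3 * 2 ^ 33" and ?c1.0 = "2 ^ 34" and ?c2.0 = 0 and ?c3.0 = "7 * 2 ^ 33"
        and w = "(-2503405, 1892776)" and D = directions and ?B1.0 = "curve_points ! 3" and ?B2.0 = "curve_points ! 4"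
        and As = "drop 5 (butlast curve_points) @ T' @ S' @ take 2 (tl curve_points)", folded proj_def, OF _ _ _ follows])
    show "\<forall>Q \<in> set (q3 # q4 # ?Ps). 2 \<le> length Q"
      using len7 length by (auto simp: Qs)
    show "map (map proj) ?Ps = map (map real_pt) (drop 5 (butlast curve_points) @ T' @ S' @ take 2 (tl curve_points))"
      using proj S(6) T(6) by (simp add: Qs curve_points_def)
    show "map proj q3 = map real_pt (curve_points ! 3)" "map proj q4 = map real_pt (curve_points ! 4)"
      using proj by (simp_all add: Qs curve_points_def)
    show "arc_certificate directions [curve_points ! 3, curve_points ! 4]"
      by (rule arc_certificate_cap)
    show "successively (\<lambda>P Q. last P = hd Q) (?Ps @ [q3, q4])"
      using chain S T by (auto simp: Qs successively_append_iff successively_Cons)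
    show "last q4 = hd (hd ?Ps)"
      using chain by (simp add: Qs)
  qed (use cert in simp_all)
  moreover have "(\<Union>Q \<in> set (q3 # q4 # ?Ps). path_image (path_of Q)) = (\<Union>Q \<in> set Qs. path_image (path_of Q))"
  proof -
    have "(\<Union>Q \<in> set (q3 # q4 # ?Ps). path_image (path_of Q)) =
        (\<Union>Q \<in> set [q1, q2, q3, q4, q5, q6, q7, q8, q9, q10, q11, q12, q13, q14]. path_image (path_of Q)) \<union>
        (\<Union>Q \<in> set S. path_image (path_of Q)) \<union> (\<Union>Q \<in> set T. path_image (path_of Q))"
      by auto
    then show ?thesis
      unfolding S(5) T(5) by (auto simp: Qs)
  qed
  ultimately show ?thesis
    by simp
qed

lemma bezier_certified:
  defines "As \<equiv> drop 5 (butlast curve_points) @ refined_points_15 @ refined_points_0 @ take 2 (tl curve_points)"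
  shows "arc_certificate directions As"
    "cap_certificate (-2503405, 1892776) As (curve_points ! 3) (curve_points ! 4)"
  unfolding As_def by code_simp+

text \<open>Further subdivision would change the polygon, so its first part is cut at the vertex of
  index 2 instead, which both sublists contain; the last part stays whole.\<close>

lemma pl_certified:
  defines "As \<equiv> drop 5 (butlast curve_points) @ [last curve_points] @
      [take 3 (hd curve_points), drop 2 (hd curve_points)] @ take 2 (tl curve_points)"
  shows "arc_certificate directions As"
    "cap_certificate (-2503405, 1892776) As (curve_points ! 3) (curve_points ! 4)"
  unfolding As_def by code_simp+

lemma proj_ends:
  defines "Qs \<equiv> (subdivide ^^ 4) [control_points]"
  shows "map proj (hd Qs) = map real_pt (hd curve_points)" "map proj (last Qs) = map real_pt (last curve_points)"
    "length (hd Qs) = 7" "length (last Qs) = 7"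
proof -
  have "length Qs = 16"
    by (simp add: Qs_def length_iterated_subdivide)
  then have ne: "Qs \<noteq> []"
    by auto
  then show "map proj (hd Qs) = map real_pt (hd curve_points)" "map proj (last Qs) = map real_pt (last curve_points)"
    using arg_cong[OF proj_subdivision, of hd] arg_cong[OF proj_subdivision, of last]
    by (simp_all add: Qs_def hd_map last_map curve_points_def)
  have "\<forall>Q \<in> set Qs. length Q = 7"
    unfolding Qs_def by (rule length_in_iterated_subdivide) (simp add: control_points_def)
  then show "length (hd Qs) = 7" "length (last Qs) = 7"
    using ne by auto
qed

lemma bezier_curve_mutually_isotopic_standard_circle:
  "mutually_isotopic (bezier_curve control_points) standard_circle"
proof -
  let ?Qs = "(subdivide ^^ 4) [control_points]"
  define P Q where "P = hd ?Qs" and "Q = last ?Qs"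
  have ne: "P \<noteq> []" "Q \<noteq> []" and len: "length P = 7" "length Q = 7"
    using proj_ends unfolding P_def Q_def by fastforce+
  have ne': "subdivide_left P \<noteq> []"
    using len by (metis length_0_conv length_subdivide(1) ne(1))
  \<comment> \<open>The corner is the start of \<open>P\<close> and the end of \<open>Q\<close>,
    hence the repeated left half of \<open>P\<close>. The refinement does not change the image of
    the curve.\<close>
  let ?S = "[subdivide_left (subdivide_left P), subdivide_right (subdivide_left P), subdivide_right P]"
    and ?T = "[subdivide_left Q, subdivide_right Q]"
  have "mutually_isotopic (\<Union>Q \<in> set ?Qs. path_image (bezier Q)) standard_circle"
  proof (rule refined_subdivision_mutually_isotopic_standard_circle[OF follows_bezier _ _ _ _ _ _ _ _ _ _ _ _ _
        bezier_certified, folded P_def Q_def])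
    show "\<forall>Q \<in> set (?S @ ?T). 2 \<le> length Q"
      using len by simp
    show "successively (\<lambda>P Q. last P = hd Q) ?S" "successively (\<lambda>P Q. last P = hd Q) ?T"
      "hd (hd ?S) = hd P" "last (last ?S) = last P" "hd (hd ?T) = hd Q" "last (last ?T) = last Q"
      using ne ne' by (simp_all add: subdivide_ends)
    show "(\<Union>Q \<in> set ?S. path_image (bezier Q)) = path_image (bezier P)"
      using bezier_curve_subdivide[OF ne(1)] bezier_curve_subdivide[OF ne'] by (simp add: bezier_curve_def Un_assoc)
    show "(\<Union>Q \<in> set ?T. path_image (bezier Q)) = path_image (bezier Q)"
      using bezier_curve_subdivide[OF ne(2)] by (simp add: bezier_curve_def)
    have "map (map proj) ?S = [subdivide_left (subdivide_left (map proj P)),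
        subdivide_right (subdivide_left (map proj P)), subdivide_right (map proj P)]"
      by (simp add: map_subdivide_left[OF linear_proj] map_subdivide_right[OF linear_proj])
    also have "\<dots> = map (map real_pt) refined_points_0"
      using proj_ends(1) unfolding P_def[symmetric]
      by (simp add: subdivide_left_rec subdivide_right_rec midpoint_Pair curve_points_def refined_points_0_def real_pt_def)
    finally show "map (map proj) ?S = map (map real_pt) refined_points_0" .
    have "map (map proj) ?T = [subdivide_left (map proj Q), subdivide_right (map proj Q)]"
      by (simp add: map_subdivide_left[OF linear_proj] map_subdivide_right[OF linear_proj])
    also have "\<dots> = map (map real_pt) refined_points_15"
      using proj_ends(2) unfolding Q_def[symmetric]
      by (simp add: subdivide_left_rec subdivide_right_rec midpoint_Pair curve_points_def refined_points_15_def real_pt_def)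
    finally show "map (map proj) ?T = map (map real_pt) refined_points_15" .
  qed simp_all
  moreover have "bezier_curve control_points = (\<Union>Q \<in> set ?Qs. path_image (bezier Q))"
    using bezier_curve_iterated_subdivide[of "[control_points]" 4]
    by (simp add: bezier_curve_def control_points_def)
  ultimately show ?thesis
    by simp
qed

lemma subdivision_polygon_mutually_isotopic_standard_circle:
  "mutually_isotopic (subdivision_polygon 4 control_points) standard_circle"
proof -
  let ?Qs = "(subdivide ^^ 4) [control_points]"
  define P Q where "P = hd ?Qs" and "Q = last ?Qs"
  have len: "length P = 7" "length Q = 7"
    using proj_ends unfolding P_def Q_def by auto
  then obtain a b c d e f g where P: "P = [a, b, c, d, e, f, g]"
    by (auto simp: numeral_eq_Suc length_Suc_conv)
  have "mutually_isotopic (\<Union>Q \<in> set ?Qs. path_image (pl_path Q)) standard_circle"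
  proof (rule refined_subdivision_mutually_isotopic_standard_circle[OF follows_pl_path _ _ _ _ _ _ _ _ _ _ _ _ _
        pl_certified, folded P_def Q_def])
    show "\<forall>R \<in> set ([take 3 P, drop 2 P] @ [Q]). 2 \<le> length R"
      using len by simp
    show "successively (\<lambda>P Q. last P = hd Q) [take 3 P, drop 2 P]"
      "hd (hd [take 3 P, drop 2 P]) = hd P" "last (last [take 3 P, drop 2 P]) = last P"
      by (simp_all add: P)
    have "pl_curve P = pl_curve (take 3 P) \<union> pl_curve (drop 2 P)"
      by (auto simp: P pl_curve_Cons pl_curve_singleton)
    then show "(\<Union>Q \<in> set [take 3 P, drop 2 P]. path_image (pl_path Q)) = path_image (pl_path P)"
      using len by (simp add: path_image_pl_path)
    show "map (map proj) [take 3 P, drop 2 P] = map (map real_pt) [take 3 (hd curve_points), drop 2 (hd curve_points)]"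
      using proj_ends(1) unfolding P_def[symmetric] by (simp flip: take_map drop_map)
    show "map (map proj) [Q] = map (map real_pt) [last curve_points]"
      using proj_ends(2) unfolding Q_def[symmetric] by simp
  qed simp_all
  moreover have "\<forall>Q \<in> set ?Qs. length Q = 7"
    by (rule length_in_iterated_subdivide) (simp add: control_points_def)
  ultimately show ?thesis
    by (simp add: subdivision_polygon_def path_image_pl_path)
qed

text \<open>From the curve to the circle, then back from the circle to the polygon: the second leg
  uses the reverse direction kept in \<open>mutually_isotopic\<close>.\<close>

theorem corollary8p1:
  shows "ambient_isotopic (bezier_curve control_points) (subdivision_polygon 4 control_points)
    \<and> unknot (subdivision_polygon 4 control_points)"
  using bezier_curve_mutually_isotopic_standard_circle subdivision_polygon_mutually_isotopic_standard_circle
    ambient_isotopic_trans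
  unfolding mutually_isotopic_def unknot_def by blast

end
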